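(* Let $\mathcal{T}$ be a triangulated category. Every map of (exact) triangles in $\mathcal{T}$ is a composite of two maps of triangles, each of which is both good and Verdier good.
   Context: $\mathcal{T}$ is a triangulated category with self-equivalence $\Sigma$. "Exact triangle" or "triangle" means distinguished triangle. A map of triangles $(f,g,h)$ from $X\xrightarrow{u}Y\xrightarrow{v}Z\xrightarrow{w}\Sigma X$ to $X'\xrightarrow{u'}Y'\xrightarrow{v'}Z'\xrightarrow{w'}\Sigma X'$ consists of $f\colon X\to X'$, $g\colon Y\to Y'$, $h\colon Z\to Z'$ with $gu=u'f$, $hv=v'g$, $(\Sigma f)w=w'h$. Composition is componentwise. The mapping cone of $(f,g,h)$ is the sequence $X'\oplus Y\to Y'\oplus Z\to Z'\oplus\Sigma X\to\Sigma X'\oplus\Sigma Y$ with successive maps $\begin{bmatrix}u'&g\\0&-v\end{bmatrix},\begin{bmatrix}v'&h\\0&-w\end{bmatrix},\begin{bmatrix}w'&\Sigma f\\0&-\Sigma u\end{bmatrix}$ (acting on column vectors). $(f,g,h)$ is good if its mapping cone is an exact triangle. Octahedra: given composable maps $P\xrightarrow{a}Q\xrightarrow{b}R$ and exact triangles $P\xrightarrow{a}Q\xrightarrow{a'}C_a\xrightarrow{a''}\Sigma P$, $Q\xrightarrow{b}R\xrightarrow{b'}C_b\xrightarrow{b''}\Sigma Q$, $P\xrightarrow{ba}R\xrightarrow{c'}C\xrightarrow{c''}\Sigma P$, an octahedron for the composite $ba$ consists of maps $\alpha\colon C_a\to C$, $\beta\colon C\to C_b$, $\gamma\colon C_b\to\Sigma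 C_a$ such that $C_a\xrightarrow{\alpha}C\xrightarrow{\beta}C_b\xrightarrow{\gamma}\Sigma C_a$ is exact and $\alpha a'=c'b$, $c''\alpha=a''$, $\beta c'=b'$, $\gamma=(\Sigma a')b''$, $b''\beta=(\Sigma a)c''$. Verdier good: choose exact triangles $X\xrightarrow{f}X'\xrightarrow{f'}X''\xrightarrow{f''}\Sigma X$, $Y\xrightarrow{g}Y'\xrightarrow{g'}Y''\xrightarrow{g''}\Sigma Y$ and $X\xrightarrow{gu=u'f}Y'\xrightarrow{\tilde v}A\xrightarrow{\tilde w}\Sigma X$. The map $(f,g,h)$ is Verdier good if there exist an octahedron $(\alpha_1\colon Z\to A,\ \beta_1\colon A\to Y'',\ \gamma_1)$ for the composite $X\xrightarrow{u}Y\xrightarrow{g}Y'$ and an octahedron $(\alpha_2\colon X''\to A,\ \beta_2\colon A\to Z',\ \gamma_2)$ for the composite $X\xrightarrow{f}X'\xrightarrow{u'}Y'$ (both using the given and chosen triangles, in particular the same triangle on $gu=u'f$) such that $h=\beta_2\alpha_1$. This does not depend on the chosen triangles. *)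

theory Defs
  imports "HOL-Algebra.Group"
begin

section \<open>Categories\<close>

record ('o, 'm) cat =
  Ob :: "'o set"
  Ar :: "'m set"
  Dom :: "'m \<Rightarrow> 'o"
  Cod :: "'m \<Rightarrow> 'o"
  Ide :: "'o \<Rightarrow> 'm"
  Comp :: "'m \<Rightarrow> 'm \<Rightarrow> 'm"  (infixr \<open>\<cdot>\<index>\<close> 70)

definition Hom :: "('o, 'm, 'x) cat_scheme \<Rightarrow> 'o \<Rightarrow> 'o \<Rightarrow> 'm set" where
  "Hom C X Y = {f \<in> Ar C. Dom C f = X \<and> Cod C f = Y}"

locale category =
  fixes C :: "('o, 'm, 'x) cat_scheme" (structure)
  assumes Dom_in_Ob: "f \<in> Ar C \<Longrightarrow> Dom C f \<in> Ob C"
    and Cod_in_Ob: "f \<in> Ar C \<Longrightarrow> Cod C f \<in> Ob C"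
    and Ide_in_Hom: "X \<in> Ob C \<Longrightarrow> Ide C X \<in> Hom C X X"
    and Comp_in_Hom: "\<lbrakk>f \<in> Hom C X Y; g \<in> Hom C Y Z\<rbrakk> \<Longrightarrow> g \<cdot> f \<in> Hom C X Z"
    and Comp_assoc:
      "\<lbrakk>f \<in> Hom C W X; g \<in> Hom C X Y; h \<in> Hom C Y Z\<rbrakk> \<Longrightarrow> (h \<cdot> g) \<cdot> f = h \<cdot> (g \<cdot> f)"
    and Comp_Ide_right: "f \<in> Hom C X Y \<Longrightarrow> f \<cdot> Ide C X = f"
    and Comp_Ide_left: "f \<in> Hom C X Y \<Longrightarrow> Ide C Y \<cdot> f = f"

definition is_iso :: "('o, 'm, 'x) cat_scheme \<Rightarrow> 'm \<Rightarrow> bool" where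
  "is_iso C f \<longleftrightarrow> f \<in> Ar C \<and>
     (\<exists>g \<in> Hom C (Cod C f) (Dom C f).
        g \<cdot>\<^bsub>C\<^esub> f = Ide C (Dom C f) \<and> f \<cdot>\<^bsub>C\<^esub> g = Ide C (Cod C f))"

definition is_zero_object :: "('o, 'm, 'x) cat_scheme \<Rightarrow> 'o \<Rightarrow> bool" where
  "is_zero_object C Z \<longleftrightarrow> Z \<in> Ob C \<and>
     (\<forall>X \<in> Ob C. (\<exists>!f. f \<in> Hom C X Z) \<and> (\<exists>!f. f \<in> Hom C Z X))"

definition endofunctor ::
  "('o, 'm, 'x) cat_scheme \<Rightarrow> ('o \<Rightarrow> 'o) \<Rightarrow> ('m \<Rightarrow> 'm) \<Rightarrow> bool" where
  "endofunctor C Fo Fm \<longleftrightarrow>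
     (\<forall>X \<in> Ob C. Fo X \<in> Ob C \<and> Fm (Ide C X) = Ide C (Fo X)) \<and>
     (\<forall>X Y. \<forall>f \<in> Hom C X Y. Fm f \<in> Hom C (Fo X) (Fo Y)) \<and>
     (\<forall>X Y Z. \<forall>f \<in> Hom C X Y. \<forall>g \<in> Hom C Y Z. Fm (g \<cdot>\<^bsub>C\<^esub> f) = Fm g \<cdot>\<^bsub>C\<^esub> Fm f)"

definition natural_iso ::
  "('o, 'm, 'x) cat_scheme \<Rightarrow> ('o \<Rightarrow> 'o) \<Rightarrow> ('m \<Rightarrow> 'm) \<Rightarrow> ('o \<Rightarrow> 'o) \<Rightarrow> ('m \<Rightarrow> 'm)
     \<Rightarrow> ('o \<Rightarrow> 'm) \<Rightarrow> bool" where
  "natural_iso C Fo Fm Go Gm \<eta> \<longleftrightarrow>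
     (\<forall>X \<in> Ob C. \<eta> X \<in> Hom C (Fo X) (Go X) \<and> is_iso C (\<eta> X)) \<and>
     (\<forall>X Y. \<forall>f \<in> Hom C X Y. Gm f \<cdot>\<^bsub>C\<^esub> \<eta> X = \<eta> Y \<cdot>\<^bsub>C\<^esub> Fm f)"

definition self_equivalence ::
  "('o, 'm, 'x) cat_scheme \<Rightarrow> ('o \<Rightarrow> 'o) \<Rightarrow> ('m \<Rightarrow> 'm) \<Rightarrow> bool" where
  "self_equivalence C Fo Fm \<longleftrightarrow> endofunctor C Fo Fm \<and>
     (\<exists>Go Gm. endofunctor C Go Gm \<and>
        (\<exists>\<eta>. natural_iso C (Go \<circ> Fo) (Gm \<circ> Fm) id id \<eta>) \<and>
        (\<exists>\<epsilon>. natural_iso C (Fo \<circ> Go) (Fm \<circ> Gm) id id \<epsilon>))"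

section \<open>Additive categories\<close>

record ('o, 'm) add_cat = "('o, 'm) cat" +
  HAdd :: "'m \<Rightarrow> 'm \<Rightarrow> 'm"  (infixl \<open>\<boxplus>\<index>\<close> 65)
  HZero :: "'o \<Rightarrow> 'o \<Rightarrow> 'm"

definition hom_group :: "('o, 'm, 'x) add_cat_scheme \<Rightarrow> 'o \<Rightarrow> 'o \<Rightarrow> 'm monoid" where
  "hom_group A X Y = \<lparr>carrier = Hom A X Y, monoid.mult = HAdd A, one = HZero A X Y\<rparr>"

definition hneg :: "('o, 'm, 'x) add_cat_scheme \<Rightarrow> 'm \<Rightarrow> 'm" where
  "hneg A f = m_inv (hom_group A (Dom A f) (Cod A f)) f"

definition is_biproduct ::
  "('o, 'm, 'x) add_cat_scheme \<Rightarrow> 'o \<Rightarrow> 'o \<Rightarrow> 'o \<Rightarrow> 'm \<Rightarrow> 'm \<Rightarrow> 'm \<Rightarrow> 'm \<Rightarrow> bool" where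
  "is_biproduct A X Y W i1 i2 p1 p2 \<longleftrightarrow>
     i1 \<in> Hom A X W \<and> i2 \<in> Hom A Y W \<and> p1 \<in> Hom A W X \<and> p2 \<in> Hom A W Y \<and>
     p1 \<cdot>\<^bsub>A\<^esub> i1 = Ide A X \<and> p2 \<cdot>\<^bsub>A\<^esub> i2 = Ide A Y \<and>
     p1 \<cdot>\<^bsub>A\<^esub> i2 = HZero A Y X \<and> p2 \<cdot>\<^bsub>A\<^esub> i1 = HZero A X Y \<and>
     (i1 \<cdot>\<^bsub>A\<^esub> p1) \<boxplus>\<^bsub>A\<^esub> (i2 \<cdot>\<^bsub>A\<^esub> p2) = Ide A W"

locale additive_category = category A
  for A :: "('o, 'm, 'x) add_cat_scheme" (structure) +
  assumes comm_group_Hom: "\<lbrakk>X \<in> Ob A; Y \<in> Ob A\<rbrakk> \<Longrightarrow> comm_group (hom_group A X Y)"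
    and Comp_HAdd_right:
      "\<lbrakk>f \<in> Hom A X Y; f' \<in> Hom A X Y; g \<in> Hom A Y Z\<rbrakk>
        \<Longrightarrow> g \<cdot> (f \<boxplus> f') = (g \<cdot> f) \<boxplus> (g \<cdot> f')"
    and Comp_HAdd_left:
      "\<lbrakk>f \<in> Hom A X Y; g \<in> Hom A Y Z; g' \<in> Hom A Y Z\<rbrakk>
        \<Longrightarrow> (g \<boxplus> g') \<cdot> f = (g \<cdot> f) \<boxplus> (g' \<cdot> f)"
    and ex_zero_object: "\<exists>Z. is_zero_object A Z"
    and ex_biproduct:
      "\<lbrakk>X \<in> Ob A; Y \<in> Ob A\<rbrakk> \<Longrightarrow> \<exists>W i1 i2 p1 p2. is_biproduct A X Y W i1 i2 p1 p2"

text \<open>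
  The morphism with matrix
  \<open>a b\<close> (first row), \<open>c d\<close> (second row), acting on column vectors, where \<open>p1\<close>, \<open>p2\<close> are the
  projections of the source biproduct and \<open>j1\<close>, \<open>j2\<close> the injections of the target biproduct.
\<close>

definition matrix_map ::
  "('o, 'm, 'x) add_cat_scheme \<Rightarrow> 'm \<Rightarrow> 'm \<Rightarrow> 'm \<Rightarrow> 'm \<Rightarrow> 'm \<Rightarrow> 'm \<Rightarrow> 'm \<Rightarrow> 'm \<Rightarrow> 'm" where
  "matrix_map A j1 j2 a b c d p1 p2 =
     (j1 \<cdot>\<^bsub>A\<^esub> ((a \<cdot>\<^bsub>A\<^esub> p1) \<boxplus>\<^bsub>A\<^esub> (b \<cdot>\<^bsub>A\<^esub> p2))) \<boxplus>\<^bsub>A\<^esub>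
     (j2 \<cdot>\<^bsub>A\<^esub> ((c \<cdot>\<^bsub>A\<^esub> p1) \<boxplus>\<^bsub>A\<^esub> (d \<cdot>\<^bsub>A\<^esub> p2)))"

section \<open>Triangulated categories\<close>

text \<open>
  A sequence \<open>X \<rightarrow> Y \<rightarrow> Z \<rightarrow> \<Sigma>X\<close> is represented by the triple of its three morphisms; the objects are
  their domains and codomains.  \<open>SigO\<close> and \<open>SigM\<close> are the shift on objects and on morphisms, and
  \<open>Exact\<close> is the class of distinguished triangles.
\<close>

record ('o, 'm) tri_cat = "('o, 'm) add_cat" +
  SigO :: "'o \<Rightarrow> 'o"
  SigM :: "'m \<Rightarrow> 'm"
  Exact :: "('m \<times> 'm \<times> 'm) set"

definition is_sequence :: "('o, 'm, 'x) tri_cat_scheme \<Rightarrow> 'm \<times> 'm \<times> 'm \<Rightarrow> bool" where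
  "is_sequence T = (\<lambda>(u, v, w). \<exists>X Y Z.
     u \<in> Hom T X Y \<and> v \<in> Hom T Y Z \<and> w \<in> Hom T Z (SigO T X))"

definition sequence_map ::
  "('o, 'm, 'x) tri_cat_scheme \<Rightarrow> 'm \<times> 'm \<times> 'm \<Rightarrow> 'm \<times> 'm \<times> 'm \<Rightarrow> 'm \<times> 'm \<times> 'm \<Rightarrow> bool" where
  "sequence_map T = (\<lambda>(u, v, w) (u', v', w') (f, g, h).
     is_sequence T (u, v, w) \<and> is_sequence T (u', v', w') \<and>
     f \<in> Hom T (Dom T u) (Dom T u') \<and>
     g \<in> Hom T (Dom T v) (Dom T v') \<and>
     h \<in> Hom T (Dom T w) (Dom T w') \<and>
     g \<cdot>\<^bsub>T\<^esub> u = u' \<cdot>\<^bsub>T\<^esub> f \<and>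
     h \<cdot>\<^bsub>T\<^esub> v = v' \<cdot>\<^bsub>T\<^esub> g \<and>
     SigM T f \<cdot>\<^bsub>T\<^esub> w = w' \<cdot>\<^bsub>T\<^esub> h)"

definition triangle_map ::
  "('o, 'm, 'x) tri_cat_scheme \<Rightarrow> 'm \<times> 'm \<times> 'm \<Rightarrow> 'm \<times> 'm \<times> 'm \<Rightarrow> 'm \<times> 'm \<times> 'm \<Rightarrow> bool" where
  "triangle_map T t t' \<phi> \<longleftrightarrow> t \<in> Exact T \<and> t' \<in> Exact T \<and> sequence_map T t t' \<phi>"

definition comp_map ::
  "('o, 'm, 'x) tri_cat_scheme \<Rightarrow> 'm \<times> 'm \<times> 'm \<Rightarrow> 'm \<times> 'm \<times> 'm \<Rightarrow> 'm \<times> 'm \<times> 'm" where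
  "comp_map T = (\<lambda>(f2, g2, h2) (f1, g1, h1). (f2 \<cdot>\<^bsub>T\<^esub> f1, g2 \<cdot>\<^bsub>T\<^esub> g1, h2 \<cdot>\<^bsub>T\<^esub> h1))"

text \<open>
  For \<open>P \<rightarrow> Q\<close> and \<open>Q \<rightarrow> R\<close> given by \<open>a\<close> and \<open>b\<close>, the three triples are exact triangles on \<open>a\<close>, on
  \<open>b\<close> and on the composite \<open>b \<cdot> a\<close>.
\<close>

definition octahedron ::
  "('o, 'm, 'x) tri_cat_scheme \<Rightarrow> 'm \<times> 'm \<times> 'm \<Rightarrow> 'm \<times> 'm \<times> 'm \<Rightarrow> 'm \<times> 'm \<times> 'm
     \<Rightarrow> 'm \<times> 'm \<times> 'm \<Rightarrow> bool" where
  "octahedron T = (\<lambda>(a, a', a'') (b, b', b'') (c, c', c'') (\<alpha>, \<beta>, \<gamma>).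
     (a, a', a'') \<in> Exact T \<and> (b, b', b'') \<in> Exact T \<and> (c, c', c'') \<in> Exact T \<and>
     Cod T a = Dom T b \<and> c = b \<cdot>\<^bsub>T\<^esub> a \<and>
     \<alpha> \<in> Hom T (Cod T a') (Cod T c') \<and>
     \<beta> \<in> Hom T (Cod T c') (Cod T b') \<and>
     \<gamma> \<in> Hom T (Cod T b') (SigO T (Cod T a')) \<and>
     (\<alpha>, \<beta>, \<gamma>) \<in> Exact T \<and>
     \<alpha> \<cdot>\<^bsub>T\<^esub> a' = c' \<cdot>\<^bsub>T\<^esub> b \<and>
     c'' \<cdot>\<^bsub>T\<^esub> \<alpha> = a'' \<and>
     \<beta> \<cdot>\<^bsub>T\<^esub> c' = b' \<and>
     \<gamma> = SigM T a' \<cdot>\<^bsub>T\<^esub> b'' \<and>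
     b'' \<cdot>\<^bsub>T\<^esub> \<beta> = SigM T a \<cdot>\<^bsub>T\<^esub> c'')"

locale triangulated_category = additive_category T
  for T :: "('o, 'm, 'x) tri_cat_scheme" (structure) +
  assumes Sigma_equivalence: "self_equivalence T (SigO T) (SigM T)"
    and Sigma_additive:
      "\<lbrakk>f \<in> Hom T X Y; g \<in> Hom T X Y\<rbrakk> \<Longrightarrow> SigM T (f \<boxplus> g) = SigM T f \<boxplus> SigM T g"
    and Exact_is_sequence: "t \<in> Exact T \<Longrightarrow> is_sequence T t"
    and Exact_iso_closed:
      "\<lbrakk>t \<in> Exact T; sequence_map T t t' (f, g, h); is_iso T f; is_iso T g; is_iso T h\<rbrakk>
        \<Longrightarrow> t' \<in> Exact T"
    and Exact_Ide:
      "\<lbrakk>X \<in> Ob T; is_zero_object T Z\<rbrakk>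
        \<Longrightarrow> (Ide T X, HZero T X Z, HZero T Z (SigO T X)) \<in> Exact T"
    and Exact_extend: "u \<in> Ar T \<Longrightarrow> \<exists>v w. (u, v, w) \<in> Exact T"
    and Exact_rotate:
      "is_sequence T (u, v, w)
        \<Longrightarrow> (u, v, w) \<in> Exact T \<longleftrightarrow> (v, w, hneg T (SigM T u)) \<in> Exact T"
    and Exact_fill_in:
      "\<lbrakk>(u, v, w) \<in> Exact T; (u', v', w') \<in> Exact T;
        f \<in> Hom T (Dom T u) (Dom T u'); g \<in> Hom T (Cod T u) (Cod T u'); g \<cdot> u = u' \<cdot> f\<rbrakk>
        \<Longrightarrow> \<exists>h. sequence_map T (u, v, w) (u', v', w') (f, g, h)"
    and ex_octahedron:
      "\<lbrakk>(a, a', a'') \<in> Exact T; (b, b', b'') \<in> Exact T; Cod T a = Dom T b;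
        (b \<cdot> a, c', c'') \<in> Exact T\<rbrakk>
        \<Longrightarrow> \<exists>\<alpha> \<beta> \<gamma>. octahedron T (a, a', a'') (b, b', b'') (b \<cdot> a, c', c'') (\<alpha>, \<beta>, \<gamma>)"

section \<open>Good and Verdier good maps of triangles\<close>

text \<open>
  The direct sums \<open>X' \<oplus> Y\<close>, \<open>Y' \<oplus> Z\<close> and \<open>Z' \<oplus> \<Sigma>X\<close> are only determined up to isomorphism, so
  they enter as chosen biproducts; as \<open>Exact T\<close> is closed under isomorphism, the choice is
  immaterial.  The last term \<open>\<Sigma>X' \<oplus> \<Sigma>Y\<close> of the mapping cone is \<open>\<Sigma>(X' \<oplus> Y)\<close>, a biproduct with
  injections \<open>\<Sigma>i1\<close> and \<open>\<Sigma>i2\<close> because \<open>\<Sigma>\<close> is additive.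
\<close>

definition good ::
  "('o, 'm, 'x) tri_cat_scheme \<Rightarrow> 'm \<times> 'm \<times> 'm \<Rightarrow> 'm \<times> 'm \<times> 'm \<Rightarrow> 'm \<times> 'm \<times> 'm \<Rightarrow> bool" where
  "good T = (\<lambda>(u, v, w) (u', v', w') (f, g, h).
     \<exists>W1 i1 i2 p1 p2 W2 j1 j2 q1 q2 W3 k1 k2 r1 r2.
       is_biproduct T (Dom T u') (Dom T v) W1 i1 i2 p1 p2 \<and>
       is_biproduct T (Dom T v') (Dom T w) W2 j1 j2 q1 q2 \<and>
       is_biproduct T (Dom T w') (SigO T (Dom T u)) W3 k1 k2 r1 r2 \<and>
       (matrix_map T j1 j2
          u'                           g
          (HZero T (Dom T u') (Cod T v)) (hneg T v) p1 p2,
        matrix_map T k1 k2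
          v'                           h
          (HZero T (Dom T v') (Cod T w)) (hneg T w) q1 q2,
        matrix_map T (SigM T i1) (SigM T i2)
          w'                           (SigM T f)
          (HZero T (Dom T w') (SigO T (Cod T u))) (hneg T (SigM T u)) r1 r2) \<in> Exact T)"

text \<open>
  The auxiliary triangles on \<open>f\<close>, \<open>g\<close> and \<open>g \<cdot> u\<close> exist by \<open>Exact_extend\<close>, and the notion does not
  depend on which ones are chosen.  For a map of triangles \<open>g \<cdot> u = u' \<cdot> f\<close>, so both octahedra may
  use the same triangle on this morphism.
\<close>

definition verdier_good ::
  "('o, 'm, 'x) tri_cat_scheme \<Rightarrow> 'm \<times> 'm \<times> 'm \<Rightarrow> 'm \<times> 'm \<times> 'm \<Rightarrow> 'm \<times> 'm \<times> 'm \<Rightarrow> bool" where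
  "verdier_good T = (\<lambda>(u, v, w) (u', v', w') (f, g, h).
     \<exists>f' f'' g' g'' vt wt \<alpha>1 \<beta>1 \<gamma>1 \<alpha>2 \<beta>2 \<gamma>2.
       (f, f', f'') \<in> Exact T \<and> (g, g', g'') \<in> Exact T \<and> (g \<cdot>\<^bsub>T\<^esub> u, vt, wt) \<in> Exact T \<and>
       octahedron T (u, v, w) (g, g', g'') (g \<cdot>\<^bsub>T\<^esub> u, vt, wt) (\<alpha>1, \<beta>1, \<gamma>1) \<and>
       octahedron T (f, f', f'') (u', v', w') (g \<cdot>\<^bsub>T\<^esub> u, vt, wt) (\<alpha>2, \<beta>2, \<gamma>2) \<and>
       h = \<beta>2 \<cdot>\<^bsub>T\<^esub> \<alpha>1)"

end

theory Submission
  imports Defs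
begin

text \<open>
  A map \<open>\<phi> : t \<rightarrow> t'\<close> is the composite of \<open>(1, \<phi>) : t \<rightarrow> t \<oplus> t'\<close> and the projection
  \<open>t \<oplus> t' \<rightarrow> t'\<close>. After the automorphism of \<open>t \<oplus> t'\<close> given by \<open>\<phi>\<close>, the first map is the inclusion
  of a direct summand, so it remains to treat inclusions and projections of direct sums of triangles.
  Up to contractible summands, the mapping cone of an inclusion is the complementary summand, that of
  a projection is the rotated kernel, and all other triangles in the octahedra that exhibit Verdier
  goodness are zero, \<open>t\<close>, \<open>t'\<close>, or rotations of them. All these sequences are exact because a
  sequence that is a retract up to homotopy of a sum of exact triangles is exact, by the five lemma.
\<close>

section \<open>Additive categories\<close>

text \<open>The obstacle is exactness of prescribed sequences. The axioms complete a single arrow to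
  some exact triangle, whereas mapping cones and octahedra consist of arrows given in advance. A
  retraction with a contracting homotopy is cheaper to exhibit than an isomorphism with a sum of
  triangles, since most of its entries vanish. The automorphism of the sum is never applied to a
  triangle, which would require goodness and Verdier goodness to be stable under isomorphism. It
  changes the injections and projections instead: the same sum has a second decomposition in which
  (1, \<phi>) is an injection. This is why \<open>triangle_biproduct\<close> describes an arbitrary
  decomposition. All maps of the octahedra are written down explicitly, because mere existence would
  give no control over the composite \<beta>2 \<alpha>1, which has to equal the given third
  component.\<close>

lemma in_Hom_iff: "f \<in> Hom C X Y \<longleftrightarrow> f \<in> Ar C \<and> Dom C f = X \<and> Cod C f = Y"
  by (simp add: Hom_def)

section \<open>Arrows and isomorphisms of a category\<close>

context category
begin

lemma Ar_in_Hom: "f \<in> Ar C \<Longrightarrow> f \<in> Hom C (Dom C f) (Cod C f)"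
  by (simp add: in_Hom_iff)

lemma arrow_simps [simp]:
  "f \<in> Ar C \<Longrightarrow> Dom C f \<in> Ob C"
  "f \<in> Ar C \<Longrightarrow> Cod C f \<in> Ob C"
  "X \<in> Ob C \<Longrightarrow> Ide C X \<in> Ar C"
  "X \<in> Ob C \<Longrightarrow> Dom C (Ide C X) = X"
  "X \<in> Ob C \<Longrightarrow> Cod C (Ide C X) = X"
  "\<lbrakk>f \<in> Ar C; g \<in> Ar C; Dom C g = Cod C f\<rbrakk> \<Longrightarrow> g \<cdot> f \<in> Ar C"
  "\<lbrakk>f \<in> Ar C; g \<in> Ar C; Dom C g = Cod C f\<rbrakk> \<Longrightarrow> Dom C (g \<cdot> f) = Dom C f"
  "\<lbrakk>f \<in> Ar C; g \<in> Ar C; Dom C g = Cod C f\<rbrakk> \<Longrightarrow> Cod C (g \<cdot> f) = Cod C g"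
  using Dom_in_Ob Cod_in_Ob Ide_in_Hom Comp_in_Hom[OF Ar_in_Hom[of f], of g "Cod C g"]
  by (auto simp: in_Hom_iff)

lemma comp_simps [simp]:
  "\<lbrakk>f \<in> Ar C; g \<in> Ar C; h \<in> Ar C; Dom C g = Cod C f; Dom C h = Cod C g\<rbrakk>
    \<Longrightarrow> (h \<cdot> g) \<cdot> f = h \<cdot> (g \<cdot> f)"
  "\<lbrakk>f \<in> Ar C; Dom C f = X\<rbrakk> \<Longrightarrow> f \<cdot> Ide C X = f"
  "\<lbrakk>f \<in> Ar C; Cod C f = Y\<rbrakk> \<Longrightarrow> Ide C Y \<cdot> f = f"
  using Comp_assoc[of f _ _ g _ h] Comp_Ide_right[of f X] Comp_Ide_left[of f _ Y]
  by (auto simp: in_Hom_iff)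

text \<open>Composites are kept associated to the right, where an equation for
  \<open>a \<cdot> b\<close> no longer matches once a further factor \<open>x\<close> follows. This
  form still rewrites there.\<close>

lemma comp_eq_comp:
  assumes "a \<cdot> b = c" "a \<in> Ar C" "b \<in> Ar C" "Dom C a = Cod C b"
    and "x \<in> Ar C" "Cod C x = Dom C b"
  shows "a \<cdot> (b \<cdot> x) = c \<cdot> x"
  using assms comp_simps(1)[of x b a] by simp

lemma is_isoI:
  assumes "f \<in> Hom C X Y" "g \<in> Hom C Y X" "g \<cdot> f = Ide C X" "f \<cdot> g = Ide C Y"
  shows "is_iso C f"
  using assms unfolding is_iso_def by (auto simp: in_Hom_iff)

lemma is_iso_Ide: "X \<in> Ob C \<Longrightarrow> is_iso C (Ide C X)"
  by (rule is_isoI[of _ X X "Ide C X"]) (auto simp: in_Hom_iff)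

lemma iso_cancel_left:
  assumes "is_iso C e" "f \<in> Ar C" "g \<in> Ar C" "Cod C f = Dom C e" "Cod C g = Dom C e"
    and "e \<cdot> f = e \<cdot> g"
  shows "f = g"
proof -
  obtain e' where e': "e' \<in> Ar C" "Dom C e' = Cod C e" "Cod C e' = Dom C e"
    "e' \<cdot> e = Ide C (Dom C e)"
    using assms(1) by (auto simp: is_iso_def in_Hom_iff)
  have e: "e \<in> Ar C"
    using assms(1) by (simp add: is_iso_def)
  have "(e' \<cdot> e) \<cdot> f = (e' \<cdot> e) \<cdot> g"
    using assms e e'(1,2,3) by simp
  then show ?thesis
    using assms e'(4) by simp
qed

lemma iso_cancel_right:
  assumes "is_iso C e" "f \<in> Ar C" "g \<in> Ar C" "Dom C f = Cod C e" "Dom C g = Cod C e"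
    and "f \<cdot> e = g \<cdot> e"
  shows "f = g"
proof -
  obtain e' where e': "e' \<in> Ar C" "Dom C e' = Cod C e" "Cod C e' = Dom C e"
    "e \<cdot> e' = Ide C (Cod C e)"
    using assms(1) by (auto simp: is_iso_def in_Hom_iff)
  have e: "e \<in> Ar C"
    using assms(1) by (simp add: is_iso_def)
  have "f \<cdot> (e \<cdot> e') = g \<cdot> (e \<cdot> e')"
    using assms e e'(1,2,3) comp_simps(1)[of e' e f] comp_simps(1)[of e' e g] by simp
  then show ?thesis
    using assms e'(4) by simp
qed

end

section \<open>Arithmetic of parallel arrows, and tests for equality on a biproduct\<close>

context additive_category
begin

lemma HZero_simps [simp]:
  assumes "X \<in> Ob A" "Y \<in> Ob A"
  shows "HZero A X Y \<in> Ar A" "Dom A (HZero A X Y) = X" "Cod A (HZero A X Y) = Y"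
proof -
  interpret comm_group "hom_group A X Y" by (rule comm_group_Hom[OF assms])
  have "HZero A X Y \<in> Hom A X Y"
    using one_closed by (simp add: hom_group_def)
  then show "HZero A X Y \<in> Ar A" "Dom A (HZero A X Y) = X" "Cod A (HZero A X Y) = Y"
    by (auto simp: in_Hom_iff)
qed

lemma HAdd_simps [simp]:
  assumes "f \<in> Ar A" "g \<in> Ar A" "Dom A g = Dom A f" "Cod A g = Cod A f"
  shows "f \<boxplus> g \<in> Ar A" "Dom A (f \<boxplus> g) = Dom A f" "Cod A (f \<boxplus> g) = Cod A f"
proof -
  interpret comm_group "hom_group A (Dom A f) (Cod A f)"
    using assms by (intro comm_group_Hom) auto
  have "f \<boxplus> g \<in> Hom A (Dom A f) (Cod A f)"
    using m_closed[of f g] assms by (simp add: hom_group_def in_Hom_iff)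
  then show "f \<boxplus> g \<in> Ar A" "Dom A (f \<boxplus> g) = Dom A f" "Cod A (f \<boxplus> g) = Cod A f"
    by (auto simp: in_Hom_iff)
qed

lemma hneg_simps [simp]:
  assumes "f \<in> Ar A"
  shows "hneg A f \<in> Ar A" "Dom A (hneg A f) = Dom A f" "Cod A (hneg A f) = Cod A f"
proof -
  interpret comm_group "hom_group A (Dom A f) (Cod A f)"
    using assms by (intro comm_group_Hom) auto
  have "hneg A f \<in> Hom A (Dom A f) (Cod A f)"
    using inv_closed[of f] assms unfolding hneg_def
    by (simp add: hom_group_def in_Hom_iff)
  then show "hneg A f \<in> Ar A" "Dom A (hneg A f) = Dom A f" "Cod A (hneg A f) = Cod A f"
    by (auto simp: in_Hom_iff)
qed

lemma HAdd_assoc [simp]: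
  assumes "f \<in> Ar A" "g \<in> Ar A" "h \<in> Ar A" "Dom A g = Dom A f" "Dom A h = Dom A f"
    "Cod A g = Cod A f" "Cod A h = Cod A f"
  shows "(f \<boxplus> g) \<boxplus> h = f \<boxplus> (g \<boxplus> h)"
proof -
  interpret comm_group "hom_group A (Dom A f) (Cod A f)"
    using assms by (intro comm_group_Hom) auto
  show ?thesis
    using m_assoc[of f g h] assms by (simp add: hom_group_def in_Hom_iff)
qed

lemma HAdd_commute:
  assumes "f \<in> Ar A" "g \<in> Ar A" "Dom A g = Dom A f" "Cod A g = Cod A f"
  shows "f \<boxplus> g = g \<boxplus> f"
proof -
  interpret comm_group "hom_group A (Dom A f) (Cod A f)"
    using assms by (intro comm_group_Hom) auto
  show ?thesis
    using m_comm[of f g] assms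
    unfolding hom_group_def in_Hom_iff partial_object.select_convs monoid.select_convs by blast
qed

lemma HAdd_left_commute:
  assumes "f \<in> Ar A" "g \<in> Ar A" "h \<in> Ar A" "Dom A g = Dom A f" "Dom A h = Dom A f"
    "Cod A g = Cod A f" "Cod A h = Cod A f"
  shows "f \<boxplus> (g \<boxplus> h) = g \<boxplus> (f \<boxplus> h)"
proof -
  have "(f \<boxplus> g) \<boxplus> h = (g \<boxplus> f) \<boxplus> h"
    by (subst HAdd_commute[of f g]) (use assms in simp_all)
  then show ?thesis
    using assms by simp
qed

lemmas HAdd_ac = HAdd_commute HAdd_left_commute

lemma HAdd_HZero [simp]:
  assumes "f \<in> Ar A" "Dom A f = X" "Cod A f = Y"
  shows "f \<boxplus> HZero A X Y = f" "HZero A X Y \<boxplus> f = f"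
proof -
  interpret comm_group "hom_group A X Y"
    using assms by (intro comm_group_Hom) auto
  show "f \<boxplus> HZero A X Y = f" "HZero A X Y \<boxplus> f = f"
    using l_one[of f] r_one[of f] assms by (simp_all add: hom_group_def in_Hom_iff)
qed

lemma HAdd_hneg [simp]:
  assumes "f \<in> Ar A"
  shows "f \<boxplus> hneg A f = HZero A (Dom A f) (Cod A f)"
    "hneg A f \<boxplus> f = HZero A (Dom A f) (Cod A f)"
proof -
  interpret comm_group "hom_group A (Dom A f) (Cod A f)"
    using assms by (intro comm_group_Hom) auto
  show "f \<boxplus> hneg A f = HZero A (Dom A f) (Cod A f)"
    "hneg A f \<boxplus> f = HZero A (Dom A f) (Cod A f)"
    using l_inv[of f] r_inv[of f] assms unfolding hneg_def
    by (simp_all add: hom_group_def in_Hom_iff)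
qed

lemma HAdd_hneg_left [simp]:
  assumes "f \<in> Ar A" "g \<in> Ar A" "Dom A g = Dom A f" "Cod A g = Cod A f"
  shows "f \<boxplus> (hneg A f \<boxplus> g) = g" "hneg A f \<boxplus> (f \<boxplus> g) = g"
proof -
  show "f \<boxplus> (hneg A f \<boxplus> g) = g"
    by (subst HAdd_assoc[symmetric]) (use assms in simp_all)
  show "hneg A f \<boxplus> (f \<boxplus> g) = g"
    by (subst HAdd_assoc[symmetric]) (use assms in simp_all)
qed

lemma HAdd_left_cancel:
  assumes "f \<boxplus> g = f \<boxplus> h" "f \<in> Ar A" "g \<in> Ar A" "h \<in> Ar A"
    "Dom A g = Dom A f" "Dom A h = Dom A f" "Cod A g = Cod A f" "Cod A h = Cod A f"
  shows "g = h"
proof -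
  have "hneg A f \<boxplus> (f \<boxplus> g) = hneg A f \<boxplus> (f \<boxplus> h)"
    by (simp only: assms(1))
  then show ?thesis
    using assms(2-) by simp
qed

lemma hneg_unique:
  assumes "f \<boxplus> g = HZero A (Dom A f) (Cod A f)" "f \<in> Ar A" "g \<in> Ar A"
    "Dom A g = Dom A f" "Cod A g = Cod A f"
  shows "hneg A f = g"
  using assms by (intro HAdd_left_cancel[of f "hneg A f" g]) simp_all

lemma HAdd_eq_zero_imp_eq:
  assumes "f \<boxplus> hneg A g = HZero A (Dom A f) (Cod A f)" "f \<in> Ar A" "g \<in> Ar A"
    "Dom A g = Dom A f" "Cod A g = Cod A f"
  shows "f = g"
proof (rule HAdd_left_cancel)
  show "hneg A g \<boxplus> f = hneg A g \<boxplus> g"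
    using assms by (subst HAdd_commute) simp_all
qed (use assms in simp_all)

lemma hneg_hneg [simp]: "f \<in> Ar A \<Longrightarrow> hneg A (hneg A f) = f"
  by (intro hneg_unique) simp_all

lemma hneg_HZero [simp]:
  "\<lbrakk>X \<in> Ob A; Y \<in> Ob A\<rbrakk> \<Longrightarrow> hneg A (HZero A X Y) = HZero A X Y"
  by (intro hneg_unique) simp_all

lemma hneg_HAdd [simp]:
  assumes "f \<in> Ar A" "g \<in> Ar A" "Dom A g = Dom A f" "Cod A g = Cod A f"
  shows "hneg A (f \<boxplus> g) = hneg A f \<boxplus> hneg A g"
  using assms
  by (intro hneg_unique) (simp_all add: HAdd_left_commute[of g "hneg A f" "hneg A g"])

lemma Comp_HAdd [simp]:
  "\<lbrakk>f \<in> Ar A; f' \<in> Ar A; g \<in> Ar A; Dom A f' = Dom A f; Cod A f' = Cod A f; Dom A g = Cod A f\<rbrakk>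
    \<Longrightarrow> g \<cdot> (f \<boxplus> f') = (g \<cdot> f) \<boxplus> (g \<cdot> f')"
  "\<lbrakk>f \<in> Ar A; g \<in> Ar A; g' \<in> Ar A; Dom A g' = Dom A g; Cod A g' = Cod A g; Dom A g = Cod A f\<rbrakk>
    \<Longrightarrow> (g \<boxplus> g') \<cdot> f = (g \<cdot> f) \<boxplus> (g' \<cdot> f)"
  using Comp_HAdd_right[of f "Dom A f" "Cod A f" f' g "Cod A g"]
    Comp_HAdd_left[of f "Dom A f" "Cod A f" g "Cod A g" g']
  by (auto simp: in_Hom_iff)

lemma Comp_HZero_right [simp]:
  assumes "X \<in> Ob A" "g \<in> Ar A" "Dom A g = Y"
  shows "g \<cdot> HZero A X Y = HZero A X (Cod A g)"
proof -
  have Y: "Y \<in> Ob A"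
    using assms by auto
  have "g \<cdot> (HZero A X Y \<boxplus> HZero A X Y) = g \<cdot> HZero A X Y"
    using assms Y by (subst HAdd_HZero) simp_all
  then have *: "(g \<cdot> HZero A X Y) \<boxplus> (g \<cdot> HZero A X Y) = (g \<cdot> HZero A X Y) \<boxplus> HZero A X (Cod A g)"
    using assms Y by (subst (asm) Comp_HAdd) simp_all
  show ?thesis
    by (rule HAdd_left_cancel[OF *]) (use assms Y in simp_all)
qed

lemma Comp_HZero_left [simp]:
  assumes "Z \<in> Ob A" "f \<in> Ar A" "Cod A f = Y"
  shows "HZero A Y Z \<cdot> f = HZero A (Dom A f) Z"
proof -
  have Y: "Y \<in> Ob A"
    using assms by auto
  have "(HZero A Y Z \<boxplus> HZero A Y Z) \<cdot> f = HZero A Y Z \<cdot> f"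
    using assms Y by (subst HAdd_HZero) simp_all
  then have *: "(HZero A Y Z \<cdot> f) \<boxplus> (HZero A Y Z \<cdot> f) = (HZero A Y Z \<cdot> f) \<boxplus> HZero A (Dom A f) Z"
    using assms Y by (subst (asm) Comp_HAdd) simp_all
  show ?thesis
    by (rule HAdd_left_cancel[OF *]) (use assms Y in simp_all)
qed

lemma Comp_hneg [simp]:
  assumes "f \<in> Ar A" "g \<in> Ar A" "Dom A g = Cod A f"
  shows "g \<cdot> hneg A f = hneg A (g \<cdot> f)" "hneg A g \<cdot> f = hneg A (g \<cdot> f)"
proof -
  have "(g \<cdot> f) \<boxplus> (g \<cdot> hneg A f) = HZero A (Dom A f) (Cod A g)"
    using assms by (subst Comp_HAdd(1)[symmetric]) simp_all
  then show "g \<cdot> hneg A f = hneg A (g \<cdot> f)"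
    using assms by (intro hneg_unique[symmetric]) simp_all
  have "(g \<cdot> f) \<boxplus> (hneg A g \<cdot> f) = HZero A (Dom A f) (Cod A g)"
    using assms by (subst Comp_HAdd(2)[symmetric]) simp_all
  then show "hneg A g \<cdot> f = hneg A (g \<cdot> f)"
    using assms by (intro hneg_unique[symmetric]) simp_all
qed

lemma is_iso_hneg_Ide: "X \<in> Ob A \<Longrightarrow> is_iso A (hneg A (Ide A X))"
  by (rule is_isoI[of _ X X "hneg A (Ide A X)"]) (auto simp: in_Hom_iff)

text \<open>Combined with its dual below, this reduces an equation between arrows of biproducts to
  equations between matrix entries.\<close>

lemma biproduct_eqI:
  assumes "is_biproduct A X Y W i1 i2 p1 p2" "f \<in> Ar A" "g \<in> Ar A"
    and "Cod A f = W" "Cod A g = W" "Dom A g = Dom A f"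
    and "p1 \<cdot> f = p1 \<cdot> g" "p2 \<cdot> f = p2 \<cdot> g"
  shows "f = g"
proof -
  have "((i1 \<cdot> p1) \<boxplus> (i2 \<cdot> p2)) \<cdot> f = ((i1 \<cdot> p1) \<boxplus> (i2 \<cdot> p2)) \<cdot> g"
    using assms unfolding is_biproduct_def in_Hom_iff by (subst (1 2) Comp_HAdd(2)) simp_all
  then show ?thesis
    using assms unfolding is_biproduct_def in_Hom_iff by simp
qed

lemma biproduct_eqI':
  assumes "is_biproduct A X Y W i1 i2 p1 p2" "f \<in> Ar A" "g \<in> Ar A"
    and "Dom A f = W" "Dom A g = W" "Cod A g = Cod A f"
    and "f \<cdot> i1 = g \<cdot> i1" "f \<cdot> i2 = g \<cdot> i2"
  shows "f = g"
proof -
  have eq: "f \<cdot> (i \<cdot> p) = g \<cdot> (i \<cdot> p)"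
    if "f \<cdot> i = g \<cdot> i" "i \<in> Ar A" "p \<in> Ar A" "Dom A i = Cod A p" "Cod A i = W" for i p
    using that assms(2-6)
    by (simp flip: comp_simps(1))
  have "f \<cdot> ((i1 \<cdot> p1) \<boxplus> (i2 \<cdot> p2)) = g \<cdot> ((i1 \<cdot> p1) \<boxplus> (i2 \<cdot> p2))"
    using assms eq[of i1 p1] eq[of i2 p2] unfolding is_biproduct_def in_Hom_iff
    by (subst (1 2) Comp_HAdd(1)) simp_all
  then show ?thesis
    using assms unfolding is_biproduct_def in_Hom_iff by simp
qed

end

section \<open>Exact triangles\<close>

lemma is_sequence_iff:
  "is_sequence T (u, v, w) \<longleftrightarrow> u \<in> Ar T \<and> v \<in> Ar T \<and> w \<in> Ar T \<and>
     Cod T u = Dom T v \<and> Cod T v = Dom T w \<and> Cod T w = SigO T (Dom T u)"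
  by (auto simp: is_sequence_def in_Hom_iff)

lemma (in category) endofunctor_arrow:
  assumes "endofunctor C Fo Fm" "f \<in> Ar C"
  shows "Fm f \<in> Ar C" "Dom C (Fm f) = Fo (Dom C f)" "Cod C (Fm f) = Fo (Cod C f)"
  using assms Ar_in_Hom[of f] unfolding endofunctor_def by (auto simp: in_Hom_iff)

section \<open>The shift as an additive, full and faithful functor\<close>

context triangulated_category
begin

lemma Sigma_simps [simp]:
  "X \<in> Ob T \<Longrightarrow> SigO T X \<in> Ob T"
  "X \<in> Ob T \<Longrightarrow> SigM T (Ide T X) = Ide T (SigO T X)"
  "f \<in> Ar T \<Longrightarrow> SigM T f \<in> Ar T"
  "f \<in> Ar T \<Longrightarrow> Dom T (SigM T f) = SigO T (Dom T f)"
  "f \<in> Ar T \<Longrightarrow> Cod T (SigM T f) = SigO T (Cod T f)"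
  "\<lbrakk>f \<in> Ar T; g \<in> Ar T; Dom T g = Cod T f\<rbrakk> \<Longrightarrow> SigM T (g \<cdot> f) = SigM T g \<cdot> SigM T f"
  "\<lbrakk>f \<in> Ar T; g \<in> Ar T; Dom T g = Dom T f; Cod T g = Cod T f\<rbrakk>
    \<Longrightarrow> SigM T (f \<boxplus> g) = SigM T f \<boxplus> SigM T g"
proof -
  have e: "endofunctor T (SigO T) (SigM T)"
    using Sigma_equivalence by (simp add: self_equivalence_def)
  show "X \<in> Ob T \<Longrightarrow> SigO T X \<in> Ob T"
    "X \<in> Ob T \<Longrightarrow> SigM T (Ide T X) = Ide T (SigO T X)"
    using e by (simp_all add: endofunctor_def)
  show "f \<in> Ar T \<Longrightarrow> SigM T f \<in> Ar T"
    "f \<in> Ar T \<Longrightarrow> Dom T (SigM T f) = SigO T (Dom T f)"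
    "f \<in> Ar T \<Longrightarrow> Cod T (SigM T f) = SigO T (Cod T f)"
    using endofunctor_arrow[OF e] by auto
  show "SigM T (g \<cdot> f) = SigM T g \<cdot> SigM T f"
    if "f \<in> Ar T" "g \<in> Ar T" "Dom T g = Cod T f"
    using e Ar_in_Hom[OF that(1)] Ar_in_Hom[OF that(2)] that(3)
    by (simp add: endofunctor_def)
  show "SigM T (f \<boxplus> g) = SigM T f \<boxplus> SigM T g"
    if "f \<in> Ar T" "g \<in> Ar T" "Dom T g = Dom T f" "Cod T g = Cod T f"
    using Sigma_additive[of f "Dom T f" "Cod T f" g] that by (simp add: in_Hom_iff)
qed

lemma Sigma_comp_eq:
  assumes "a \<cdot> b = c" "a \<in> Ar T" "b \<in> Ar T" "Dom T a = Cod T b"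
  shows "SigM T a \<cdot> SigM T b = SigM T c"
  unfolding assms(1)[symmetric] using assms(2-) by simp

lemma Sigma_HZero [simp]:
  assumes "X \<in> Ob T" "Y \<in> Ob T"
  shows "SigM T (HZero T X Y) = HZero T (SigO T X) (SigO T Y)"
proof -
  let ?z = "SigM T (HZero T X Y)"
  have "SigM T (HZero T X Y \<boxplus> HZero T X Y) = ?z"
    using assms by (subst HAdd_HZero) simp_all
  then have *: "?z \<boxplus> ?z = ?z \<boxplus> HZero T (SigO T X) (SigO T Y)"
    using assms by (subst (asm) Sigma_simps) simp_all
  show ?thesis
    by (rule HAdd_left_cancel[OF *]) (use assms in simp_all)
qed

lemma Sigma_hneg [simp]:
  assumes "f \<in> Ar T"
  shows "SigM T (hneg T f) = hneg T (SigM T f)"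
proof (rule hneg_unique[symmetric])
  have "SigM T (f \<boxplus> hneg T f) = HZero T (SigO T (Dom T f)) (SigO T (Cod T f))"
    using assms by (subst HAdd_hneg) simp_all
  then show "SigM T f \<boxplus> SigM T (hneg T f) = HZero T (Dom T (SigM T f)) (Cod T (SigM T f))"
    using assms by (subst (asm) Sigma_simps) simp_all
qed (use assms in simp_all)

lemma Sigma_biproduct:
  assumes "is_biproduct T X Y W i1 i2 p1 p2"
  shows "is_biproduct T (SigO T X) (SigO T Y) (SigO T W)
    (SigM T i1) (SigM T i2) (SigM T p1) (SigM T p2)"
proof -
  have *: "SigM T (p1 \<cdot> i1) = SigM T (Ide T X)" "SigM T (p2 \<cdot> i2) = SigM T (Ide T Y)"
    "SigM T (p1 \<cdot> i2) = SigM T (HZero T Y X)" "SigM T (p2 \<cdot> i1) = SigM T (HZero T X Y)"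
    "SigM T ((i1 \<cdot> p1) \<boxplus> (i2 \<cdot> p2)) = SigM T (Ide T W)"
    using assms unfolding is_biproduct_def by metis+
  have ar: "i1 \<in> Ar T" "i2 \<in> Ar T" "p1 \<in> Ar T" "p2 \<in> Ar T" "Dom T i1 = X" "Dom T i2 = Y"
    "Cod T i1 = W" "Cod T i2 = W" "Dom T p1 = W" "Dom T p2 = W" "Cod T p1 = X" "Cod T p2 = Y"
    and ob: "X \<in> Ob T" "Y \<in> Ob T" "W \<in> Ob T"
    using assms unfolding is_biproduct_def in_Hom_iff by auto
  show ?thesis
    using * ar ob unfolding is_biproduct_def in_Hom_iff by simp
qed

text \<open>By naturality \<open>f \<cdot> \<eta> X\<close> equals
  \<open>\<eta> Y \<cdot> Gm (Fm f)\<close>, so it depends on \<open>Fm f\<close> alone, and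
  \<open>\<eta> X\<close> cancels. The functor is left arbitrary so that the argument serves both
  for the shift and for its quasi-inverse.\<close>

lemma faithful_of_natural_iso:
  assumes \<eta>: "natural_iso T (Go \<circ> Fo) (Gm \<circ> Fm) id id \<eta>"
    and f: "f \<in> Hom T X Y" and g: "g \<in> Hom T X Y" and eq: "Fm f = Fm g"
  shows "f = g"
proof (rule iso_cancel_right)
  have ob: "X \<in> Ob T" "Y \<in> Ob T"
    using f by (auto simp: in_Hom_iff)
  then show "is_iso T (\<eta> X)"
    using \<eta> by (simp add: natural_iso_def)
  have "f \<cdot> \<eta> X = \<eta> Y \<cdot> Gm (Fm f)" "g \<cdot> \<eta> X = \<eta> Y \<cdot> Gm (Fm g)"
    using \<eta> f g by (auto simp: natural_iso_def)
  then show "f \<cdot> \<eta> X = g \<cdot> \<eta> X"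
    using eq by simp
  show "Dom T f = Cod T (\<eta> X)" "Dom T g = Cod T (\<eta> X)" "f \<in> Ar T" "g \<in> Ar T"
    using \<eta> f g ob by (auto simp: natural_iso_def in_Hom_iff)
qed

lemma Sigma_faithful:
  assumes "f \<in> Ar T" "g \<in> Ar T" "Dom T g = Dom T f" "Cod T g = Cod T f"
    and "SigM T f = SigM T g"
  shows "f = g"
proof -
  obtain Go Gm \<eta> where "natural_iso T (Go \<circ> SigO T) (Gm \<circ> SigM T) id id \<eta>"
    using Sigma_equivalence by (auto simp: self_equivalence_def)
  from faithful_of_natural_iso[OF this, of f "Dom T f" "Cod T f" g] show ?thesis
    using assms by (simp add: in_Hom_iff)
qed

text \<open>Conjugating \<open>Gm k\<close> by the natural isomorphism \<eta> gives the preimage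
  \<open>f\<close>. Naturality shows that \<open>SigM T f\<close> and \<open>k\<close> have the same
  image under the quasi-inverse, which is faithful by the other natural isomorphism.\<close>

lemma Sigma_full:
  assumes ob: "X \<in> Ob T" "Y \<in> Ob T" and k: "k \<in> Hom T (SigO T X) (SigO T Y)"
  obtains f where "f \<in> Hom T X Y" "SigM T f = k"
proof -
  obtain Go Gm \<eta> \<epsilon> where G: "endofunctor T Go Gm"
    and \<eta>: "natural_iso T (Go \<circ> SigO T) (Gm \<circ> SigM T) id id \<eta>"
    and \<epsilon>: "natural_iso T (SigO T \<circ> Go) (SigM T \<circ> Gm) id id \<epsilon>"
    using Sigma_equivalence by (auto simp: self_equivalence_def)
  have eta: "\<eta> Z \<in> Ar T" "Dom T (\<eta> Z) = Go (SigO T Z)" "Cod T (\<eta> Z) = Z" "is_iso T (\<eta> Z)"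
    if "Z \<in> Ob T" for Z
    using \<eta> that by (auto simp: natural_iso_def in_Hom_iff)
  obtain e where e: "e \<in> Ar T" "Dom T e = X" "Cod T e = Go (SigO T X)"
    "e \<cdot> \<eta> X = Ide T (Go (SigO T X))"
    using eta[OF ob(1)] by (auto simp: is_iso_def in_Hom_iff)
  have Gk: "Gm k \<in> Ar T" "Dom T (Gm k) = Go (SigO T X)" "Cod T (Gm k) = Go (SigO T Y)"
    using endofunctor_arrow[OF G, of k] k by (auto simp: in_Hom_iff)
  define f where "f = \<eta> Y \<cdot> (Gm k \<cdot> e)"
  have f: "f \<in> Hom T X Y"
    using eta[OF ob(1)] eta[OF ob(2)] e Gk by (simp add: f_def in_Hom_iff)
  have Gf: "Gm (SigM T f) \<in> Ar T" "Dom T (Gm (SigM T f)) = Go (SigO T X)"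
    "Cod T (Gm (SigM T f)) = Go (SigO T Y)"
    using endofunctor_arrow[OF G, of "SigM T f"] f by (auto simp: in_Hom_iff)
  have "\<eta> Y \<cdot> Gm (SigM T f) = f \<cdot> \<eta> X"
    using \<eta> f by (auto simp: natural_iso_def)
  also have "\<dots> = \<eta> Y \<cdot> Gm k"
    using eta[OF ob(1)] eta[OF ob(2)] e Gk by (simp add: f_def)
  finally have "Gm (SigM T f) = Gm k"
    by (rule iso_cancel_left[rotated -1]) (use eta[OF ob(2)] Gk Gf in simp_all)
  then have "SigM T f = k"
    by (rule faithful_of_natural_iso[OF \<epsilon>, rotated -1])
      (use f k in \<open>simp_all add: in_Hom_iff\<close>)
  with f show thesis
    by (rule that)
qed

section \<open>Vanishing composites in exact triangles, and lifting along their arrows\<close>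

lemma sequence_map_iff:
  assumes "is_sequence T (u, v, w)" "is_sequence T (u', v', w')"
  shows "sequence_map T (u, v, w) (u', v', w') (f, g, h) \<longleftrightarrow>
    f \<in> Ar T \<and> g \<in> Ar T \<and> h \<in> Ar T \<and>
    Dom T f = Dom T u \<and> Cod T f = Dom T u' \<and> Dom T g = Dom T v \<and> Cod T g = Dom T v' \<and>
    Dom T h = Dom T w \<and> Cod T h = Dom T w' \<and>
    g \<cdot> u = u' \<cdot> f \<and> h \<cdot> v = v' \<cdot> g \<and> SigM T f \<cdot> w = w' \<cdot> h"
  using assms by (auto simp: sequence_map_def in_Hom_iff)

lemma Exact_arrows:
  assumes "(u, v, w) \<in> Exact T"
  shows "u \<in> Ar T" "v \<in> Ar T" "w \<in> Ar T"
    "Cod T u = Dom T v" "Cod T v = Dom T w" "Cod T w = SigO T (Dom T u)"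
  using Exact_is_sequence[OF assms] by (simp_all add: is_sequence_iff)

lemma Exact_rotate1: "(u, v, w) \<in> Exact T \<Longrightarrow> (v, w, hneg T (SigM T u)) \<in> Exact T"
  using Exact_rotate Exact_is_sequence by blast

text \<open>Compare with the trivial triangle on the domain of \<open>u\<close>: the filled-in third
  map \<open>k\<close> starts at a zero object, and \<open>v \<cdot> u\<close> factors through
  it.\<close>

lemma Exact_comp_zero1:
  assumes "(u, v, w) \<in> Exact T"
  shows "v \<cdot> u = HZero T (Dom T u) (Cod T v)"
proof -
  obtain N where N: "is_zero_object T N" "N \<in> Ob T"
    using ex_zero_object by (auto simp: is_zero_object_def)
  note u = Exact_arrows[OF assms]
  obtain k where k: "sequence_map T
      (Ide T (Dom T u), HZero T (Dom T u) N, HZero T N (SigO T (Dom T u))) (u, v, w)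
      (Ide T (Dom T u), u, k)"
    using Exact_fill_in[OF Exact_Ide[OF _ N(1), of "Dom T u"] assms, of "Ide T (Dom T u)" u] u N
    by (auto simp: in_Hom_iff)
  have "v \<cdot> u = k \<cdot> HZero T (Dom T u) N" "k \<in> Hom T N (Cod T v)"
    using k u N by (auto simp: sequence_map_def in_Hom_iff)
  then show ?thesis
    using u N by (simp add: in_Hom_iff)
qed

lemma Exact_comp_zero:
  assumes "(u, v, w) \<in> Exact T"
  shows "v \<cdot> u = HZero T (Dom T u) (Cod T v)"
    and "w \<cdot> v = HZero T (Dom T v) (Cod T w)"
    and "SigM T u \<cdot> w = HZero T (Dom T w) (SigO T (Cod T u))"
proof -
  note u = Exact_arrows[OF assms]
  show "v \<cdot> u = HZero T (Dom T u) (Cod T v)" "w \<cdot> v = HZero T (Dom T v) (Cod T w)"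
    using Exact_comp_zero1[OF assms] Exact_comp_zero1[OF Exact_rotate1[OF assms]] by auto
  \<comment> \<open>Two rotations give a triangle that starts with w, -\<Sigma>u, so the composite
    appears with a sign, which a second negation removes.\<close>
  have "hneg T (SigM T u \<cdot> w) = HZero T (Dom T w) (SigO T (Cod T u))"
    using Exact_comp_zero1[OF Exact_rotate1[OF Exact_rotate1[OF assms]]] u by simp
  then have "hneg T (hneg T (SigM T u \<cdot> w)) = hneg T (HZero T (Dom T w) (SigO T (Cod T u)))"
    by simp
  then show "SigM T u \<cdot> w = HZero T (Dom T w) (SigO T (Cod T u))"
    using u by (subst (asm) hneg_hneg) simp_all
qed

text \<open>Fill in the map from the rotation of the trivial triangle on the domain of \<open>y\<close>, then
  desuspend.\<close>

lemma Exact_lift1: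
  assumes "(u, v, w) \<in> Exact T" "y \<in> Ar T" "Cod T y = Dom T v"
    and "v \<cdot> y = HZero T (Dom T y) (Cod T v)"
  obtains x where "x \<in> Ar T" "Dom T x = Dom T y" "Cod T x = Dom T u" "u \<cdot> x = y"
proof -
  obtain N where N: "is_zero_object T N" "N \<in> Ob T"
    using ex_zero_object by (auto simp: is_zero_object_def)
  define W where "W = Dom T y"
  have W: "W \<in> Ob T"
    using assms by (simp add: W_def)
  note u = Exact_arrows[OF assms(1)]
  obtain k where k: "sequence_map T
      (HZero T W N, HZero T N (SigO T W), hneg T (SigM T (Ide T W))) (v, w, hneg T (SigM T u))
      (y, HZero T N (Cod T v), k)"
    using Exact_fill_in[OF Exact_rotate1[OF Exact_Ide[OF W N(1)]] Exact_rotate1[OF assms(1)],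
        of y "HZero T N (Cod T v)"] assms u N W
    by (auto simp: in_Hom_iff W_def)
  have *: "SigM T y \<cdot> hneg T (SigM T (Ide T W)) = hneg T (SigM T u) \<cdot> k"
    "k \<in> Hom T (SigO T W) (SigO T (Dom T u))"
    using k u N W by (auto simp: sequence_map_def in_Hom_iff)
  have "hneg T (SigM T y) = hneg T (SigM T u \<cdot> k)"
    using * u W assms by (simp add: in_Hom_iff W_def)
  then have "hneg T (hneg T (SigM T y)) = hneg T (hneg T (SigM T u \<cdot> k))"
    by simp
  then have eq: "SigM T y = SigM T u \<cdot> k"
    using * u W assms by (simp add: in_Hom_iff W_def)
  obtain x where x: "x \<in> Hom T W (Dom T u)" "SigM T x = k"
    using Sigma_full[OF W _ *(2)] u by auto
  have "u \<cdot> x = y"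
    by (rule Sigma_faithful) (use x u assms eq in \<open>simp_all add: in_Hom_iff W_def\<close>)
  with x show thesis
    by (intro that) (auto simp: in_Hom_iff W_def)
qed

lemma Exact_lift2:
  assumes "(u, v, w) \<in> Exact T" "z \<in> Ar T" "Cod T z = Dom T w"
    and "w \<cdot> z = HZero T (Dom T z) (Cod T w)"
  obtains y where "y \<in> Ar T" "Dom T y = Dom T z" "Cod T y = Dom T v" "v \<cdot> y = z"
  using Exact_lift1[OF Exact_rotate1[OF assms(1)] assms(2-)] .

lemma Exact_lift3:
  assumes "(u, v, w) \<in> Exact T" "x \<in> Ar T" "Cod T x = SigO T (Dom T u)"
    and "SigM T u \<cdot> x = HZero T (Dom T x) (SigO T (Cod T u))"
  obtains z where "z \<in> Ar T" "Dom T z = Dom T x" "Cod T z = Dom T w" "w \<cdot> z = x"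
  by (rule Exact_lift1[OF Exact_rotate1[OF Exact_rotate1[OF assms(1)]], of x])
    (use assms Exact_arrows[OF assms(1)] in auto)

section \<open>Criteria for exactness: the five lemma and homotopy retracts\<close>

lemma Exact_of_comparison:
  assumes E: "(u, v', w') \<in> Exact T" and S: "is_sequence T (u, v, w)"
    and vu: "v \<cdot> u = HZero T (Dom T u) (Cod T v)"
    and lift2: "\<And>z. \<lbrakk>z \<in> Ar T; Cod T z = Dom T w; w \<cdot> z = HZero T (Dom T z) (Cod T w)\<rbrakk>
      \<Longrightarrow> \<exists>y \<in> Hom T (Dom T z) (Dom T v). v \<cdot> y = z"
    and lift3: "\<And>x. \<lbrakk>x \<in> Ar T; Cod T x = SigO T (Dom T u);
        SigM T u \<cdot> x = HZero T (Dom T x) (SigO T (Cod T u))\<rbrakk>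
      \<Longrightarrow> \<exists>z \<in> Hom T (Dom T x) (Dom T w). w \<cdot> z = x"
    and h: "h \<in> Hom T (Cod T v) (Cod T v')" "h \<cdot> v = v'" "w' \<cdot> h = w"
  shows "(u, v, w) \<in> Exact T"
proof -
  define X Y Z Z' where "X = Dom T u" "Y = Dom T v" "Z = Dom T w" "Z' = Dom T w'"
  have ar: "u \<in> Ar T" "v \<in> Ar T" "w \<in> Ar T" "v' \<in> Ar T" "w' \<in> Ar T" "h \<in> Ar T"
    "Dom T u = X" "Cod T u = Y" "Dom T v = Y" "Cod T v = Z" "Dom T w = Z" "Cod T w = SigO T X"
    "Dom T v' = Y" "Cod T v' = Z'" "Dom T w' = Z'" "Cod T w' = SigO T X"
    "Dom T h = Z" "Cod T h = Z'"
    using Exact_arrows[OF E] S h by (auto simp: is_sequence_iff in_Hom_iff X_Y_Z_Z'_def)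
  have ob: "X \<in> Ob T" "Y \<in> Ob T" "Z \<in> Ob T" "Z' \<in> Ob T"
    using ar arrow_simps(1)[of u] arrow_simps(1)[of v] arrow_simps(1)[of w] arrow_simps(1)[of w']
    by auto
  note zero = Exact_comp_zero[OF E, unfolded ar]
  \<comment> \<open>The five lemma with arrows as generalised elements. Lift \<open>w'\<close> along
    \<open>w\<close> to \<open>z\<close>; then \<open>w'\<close> kills 1 - h z, which is therefore
    v' y, and z + v y is a right inverse of \<open>h\<close>.\<close>
  have "SigM T u \<cdot> w' = HZero T Z' (SigO T Y)"
    by (rule zero(3))
  then obtain z where z: "z \<in> Ar T" "Dom T z = Z'" "Cod T z = Z" "w \<cdot> z = w'"
    using lift3[of w'] ar by (auto simp: in_Hom_iff)
  have "w' \<cdot> (Ide T Z' \<boxplus> hneg T (h \<cdot> z)) = HZero T Z' (SigO T X)"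
    using z ar ob comp_eq_comp[OF h(3), of z] by simp
  then obtain y where y: "y \<in> Ar T" "Dom T y = Z'" "Cod T y = Y"
    "v' \<cdot> y = Ide T Z' \<boxplus> hneg T (h \<cdot> z)"
    using Exact_lift2[OF E, of "Ide T Z' \<boxplus> hneg T (h \<cdot> z)"] z ar ob by auto
  define r where "r = z \<boxplus> (v \<cdot> y)"
  have r: "r \<in> Ar T" "Dom T r = Z'" "Cod T r = Z"
    using z y ar by (auto simp: r_def)
  have hr: "h \<cdot> r = Ide T Z'"
    using z y ar ob comp_eq_comp[OF h(2), of y]
    by (simp add: r_def HAdd_ac)
  \<comment> \<open>It remains to see that the right inverse is also a left inverse. The defect
    \<open>k\<close> is killed by \<open>h\<close>, hence by \<open>w\<close>, so it lifts to
    \<open>y2\<close> along \<open>v\<close> and then to \<open>x\<close> along \<open>u\<close>;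
    now v u = 0 finishes.\<close>
  define k where "k = (r \<cdot> h) \<boxplus> hneg T (Ide T Z)"
  have k: "k \<in> Ar T" "Dom T k = Z" "Cod T k = Z"
    using r ar ob by (auto simp: k_def)
  have hk: "h \<cdot> k = HZero T Z Z'"
    using r ar ob comp_eq_comp[OF hr, of h] by (simp add: k_def)
  have "w \<cdot> k = w' \<cdot> (h \<cdot> k)"
    using comp_eq_comp[OF h(3), of k] k ar by simp
  then have "w \<cdot> k = HZero T Z (SigO T X)"
    using hk ar ob by simp
  then have "\<exists>y \<in> Hom T Z Y. v \<cdot> y = k"
    using lift2[of k] k ar by simp
  then obtain y2 where y2: "y2 \<in> Ar T" "Dom T y2 = Z" "Cod T y2 = Y" "v \<cdot> y2 = k"
    by (auto simp: in_Hom_iff)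
  have "v' \<cdot> y2 = HZero T Z Z'"
    using comp_eq_comp[OF h(2), of y2] y2 hk ar by simp
  then obtain x where x: "x \<in> Ar T" "Dom T x = Z" "Cod T x = X" "u \<cdot> x = y2"
    using Exact_lift1[OF E, of y2] y2 ar by auto
  have "k = (v \<cdot> u) \<cdot> x"
    using x y2 ar by simp
  also have "\<dots> = HZero T Z Z"
    unfolding vu using x ar ob by simp
  finally have "k = HZero T Z Z" .
  then have "r \<cdot> h = Ide T Z"
    by (intro HAdd_eq_zero_imp_eq[of "r \<cdot> h" "Ide T Z"]) (use r ar ob in \<open>simp_all add: k_def\<close>)
  then have iso: "is_iso T r"
    using hr r ar by (intro is_isoI[of r Z' Z h]) (auto simp: in_Hom_iff)
  have rv: "r \<cdot> v' = v"
    using comp_eq_comp[OF \<open>r \<cdot> h = Ide T Z\<close>, of v] r h(2) ar by simp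
  have wr: "w \<cdot> r = w'"
    using comp_eq_comp[OF h(3), of r] hr r ar by simp
  have "sequence_map T (u, v', w') (u, v, w) (Ide T X, Ide T Y, r)"
    by (subst sequence_map_iff[OF Exact_is_sequence[OF E] S]) (use rv wr r ar ob in simp_all)
  then show ?thesis
    using Exact_iso_closed[OF E] iso is_iso_Ide ob by blast
qed

text \<open>\<open>(d1, d2, d3)\<close> contracts the part of the identity that does not factor through the two exact
  triangles; as \<open>\<Sigma>\<close> has no inverse on the nose, its equation in degree one is suspended. The term
  \<open>k \<cdot> w\<close> in the comparison map makes it compatible with the third morphisms.\<close>

lemma Exact_homotopy_retract2:
  assumes E: "(a, b, c) \<in> Exact T" and E': "(a', b', c') \<in> Exact T"
    and S: "is_sequence T (u, v, w)"
    and maps: "sequence_map T (a, b, c) (u, v, w) (i1, i2, i3)"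
      "sequence_map T (u, v, w) (a, b, c) (p1, p2, p3)"
      "sequence_map T (a', b', c') (u, v, w) (j1, j2, j3)"
      "sequence_map T (u, v, w) (a', b', c') (q1, q2, q3)"
    and zero: "v \<cdot> u = HZero T (Dom T u) (Cod T v)" "w \<cdot> v = HZero T (Dom T v) (Cod T w)"
      "SigM T u \<cdot> w = HZero T (Dom T w) (SigO T (Cod T u))"
    and d: "d1 \<in> Hom T (Dom T v) (Dom T u)" "d2 \<in> Hom T (Dom T w) (Dom T v)"
      "d3 \<in> Hom T (Cod T w) (Dom T w)"
    and homotopy: "(SigM T i1 \<cdot> SigM T p1) \<boxplus> ((SigM T j1 \<cdot> SigM T q1) \<boxplus>
        ((SigM T d1 \<cdot> SigM T u) \<boxplus> (w \<cdot> d3))) = Ide T (Cod T w)"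
      "(i2 \<cdot> p2) \<boxplus> ((j2 \<cdot> q2) \<boxplus> ((u \<cdot> d1) \<boxplus> (d2 \<cdot> v))) = Ide T (Dom T v)"
      "(i3 \<cdot> p3) \<boxplus> ((j3 \<cdot> q3) \<boxplus> ((v \<cdot> d2) \<boxplus> (d3 \<cdot> w))) = Ide T (Dom T w)"
  shows "(u, v, w) \<in> Exact T"
proof -
  define A B C where "A = Dom T a" "B = Dom T b" "C = Dom T c"
  define A' B' C' where "A' = Dom T a'" "B' = Dom T b'" "C' = Dom T c'"
  define X Y Z where "X = Dom T u" "Y = Dom T v" "Z = Dom T w"
  note defs = A_B_C_def A'_B'_C'_def X_Y_Z_def
  \<comment> \<open>An exact triangle on the same arrow \<open>u\<close>, to be compared with the
    given sequence. The lifting properties of that sequence are assembled from the two exact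
    triangles and the contraction.\<close>
  obtain v0 w0 where E0: "(u, v0, w0) \<in> Exact T"
    using Exact_extend[of u] S by (auto simp: is_sequence_iff)
  define Z0 where "Z0 = Dom T w0"
  note seqE = Exact_is_sequence[OF E] and seqE' = Exact_is_sequence[OF E']
  note m = maps(1)[unfolded sequence_map_iff[OF seqE S]]
    maps(2)[unfolded sequence_map_iff[OF S seqE]]
    maps(3)[unfolded sequence_map_iff[OF seqE' S]]
    maps(4)[unfolded sequence_map_iff[OF S seqE']]
  have ar0: "a \<in> Ar T" "b \<in> Ar T" "c \<in> Ar T" "a' \<in> Ar T" "b' \<in> Ar T" "c' \<in> Ar T"
    "u \<in> Ar T" "v \<in> Ar T" "w \<in> Ar T" "v0 \<in> Ar T" "w0 \<in> Ar T"
    "Dom T a = A" "Cod T a = B" "Dom T b = B" "Cod T b = C" "Dom T c = C" "Cod T c = SigO T A"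
    "Dom T a' = A'" "Cod T a' = B'" "Dom T b' = B'" "Cod T b' = C'" "Dom T c' = C'"
    "Cod T c' = SigO T A'"
    "Dom T u = X" "Cod T u = Y" "Dom T v = Y" "Cod T v = Z" "Dom T w = Z" "Cod T w = SigO T X"
    "Dom T v0 = Y" "Cod T v0 = Z0" "Dom T w0 = Z0" "Cod T w0 = SigO T X"
    using Exact_arrows[OF E] Exact_arrows[OF E'] Exact_arrows[OF E0] S
    unfolding is_sequence_iff by (simp_all add: defs Z0_def)
  have ar1: "i1 \<in> Ar T" "i2 \<in> Ar T" "i3 \<in> Ar T" "p1 \<in> Ar T" "p2 \<in> Ar T" "p3 \<in> Ar T"
    "j1 \<in> Ar T" "j2 \<in> Ar T" "j3 \<in> Ar T" "q1 \<in> Ar T" "q2 \<in> Ar T" "q3 \<in> Ar T"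
    "d1 \<in> Ar T" "d2 \<in> Ar T" "d3 \<in> Ar T"
    "Dom T i1 = A" "Dom T i2 = B" "Dom T i3 = C" "Cod T i1 = X" "Cod T i2 = Y" "Cod T i3 = Z"
    "Dom T p1 = X" "Dom T p2 = Y" "Dom T p3 = Z" "Cod T p1 = A" "Cod T p2 = B" "Cod T p3 = C"
    "Dom T j1 = A'" "Dom T j2 = B'" "Dom T j3 = C'" "Cod T j1 = X" "Cod T j2 = Y" "Cod T j3 = Z"
    "Dom T q1 = X" "Dom T q2 = Y" "Dom T q3 = Z" "Cod T q1 = A'" "Cod T q2 = B'" "Cod T q3 = C'"
    "Dom T d1 = Y" "Cod T d1 = X" "Dom T d2 = Z" "Cod T d2 = Y"
    "Dom T d3 = SigO T X" "Cod T d3 = Z"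
    using m d ar0 unfolding in_Hom_iff by simp_all
  note ar = ar0 ar1
  have ob: "X \<in> Ob T" "Y \<in> Ob T" "Z \<in> Ob T" "Z0 \<in> Ob T" "A \<in> Ob T" "B \<in> Ob T" "C \<in> Ob T"
    "A' \<in> Ob T" "B' \<in> Ob T" "C' \<in> Ob T"
    using ar0 arrow_simps(1) by metis+
  have rel: "i2 \<cdot> a = u \<cdot> i1" "i3 \<cdot> b = v \<cdot> i2" "SigM T i1 \<cdot> c = w \<cdot> i3"
    "p2 \<cdot> u = a \<cdot> p1" "p3 \<cdot> v = b \<cdot> p2" "SigM T p1 \<cdot> w = c \<cdot> p3"
    "j2 \<cdot> a' = u \<cdot> j1" "j3 \<cdot> b' = v \<cdot> j2" "SigM T j1 \<cdot> c' = w \<cdot> j3"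
    "q2 \<cdot> u = a' \<cdot> q1" "q3 \<cdot> v = b' \<cdot> q2" "SigM T q1 \<cdot> w = c' \<cdot> q3"
    using m by simp_all
  have "SigM T (p2 \<cdot> u) = SigM T (a \<cdot> p1)" "SigM T (q2 \<cdot> u) = SigM T (a' \<cdot> q1)"
    using rel by simp_all
  then have relS: "SigM T p2 \<cdot> SigM T u = SigM T a \<cdot> SigM T p1"
    "SigM T q2 \<cdot> SigM T u = SigM T a' \<cdot> SigM T q1"
    using ar by simp_all
  note hom = homotopy[unfolded ar]
  note z0 = zero[unfolded ar] and zE0 = Exact_comp_zero[OF E0, unfolded ar]
  \<comment> \<open>\<open>e\<close> and \<open>e'\<close> are the substitutes for \<open>i3\<close>
    and \<open>j3\<close> with target \<open>Z0\<close>. The comparison map \<open>h\<close> is the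
    third homotopy identity with \<open>i3\<close>, \<open>j3\<close>, \<open>v\<close>,
    \<open>d3\<close> replaced by \<open>e\<close>, \<open>e'\<close>, \<open>v0\<close>,
    \<open>k\<close>.\<close>
  obtain e where e: "e \<in> Ar T" "Dom T e = C" "Cod T e = Z0" "e \<cdot> b = v0 \<cdot> i2"
    "SigM T i1 \<cdot> c = w0 \<cdot> e"
    using Exact_fill_in[OF E E0, of i1 i2] ar rel sequence_map_iff[OF seqE Exact_is_sequence[OF E0]]
    by (auto simp: in_Hom_iff)
  obtain e' where e': "e' \<in> Ar T" "Dom T e' = C'" "Cod T e' = Z0" "e' \<cdot> b' = v0 \<cdot> j2"
    "SigM T j1 \<cdot> c' = w0 \<cdot> e'"
    using Exact_fill_in[OF E' E0, of j1 j2] ar rel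
      sequence_map_iff[OF seqE' Exact_is_sequence[OF E0]]
    by (auto simp: in_Hom_iff)
  have "SigM T u \<cdot> (w \<cdot> d3) = HZero T (SigO T X) (SigO T Y)"
    using comp_eq_comp[OF z0(3), of d3] ar ob by simp
  then obtain k where k: "k \<in> Ar T" "Dom T k = SigO T X" "Cod T k = Z0" "w0 \<cdot> k = w \<cdot> d3"
    using Exact_lift3[OF E0, of "w \<cdot> d3"] ar ob by auto
  define h where "h = (e \<cdot> p3) \<boxplus> ((e' \<cdot> q3) \<boxplus> ((v0 \<cdot> d2) \<boxplus> (k \<cdot> w)))"
  have hv: "h \<cdot> v = v0"
  proof -
    have "h \<cdot> v = v0 \<cdot> ((i2 \<cdot> p2) \<boxplus> ((j2 \<cdot> q2) \<boxplus> ((u \<cdot> d1) \<boxplus> (d2 \<cdot> v))))"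
      using ar ob e(1-3) e'(1-3) k(1-3) rel(5,11) z0 comp_eq_comp[OF e(4), of p2]
        comp_eq_comp[OF e'(4), of q2] comp_eq_comp[OF zE0(1), of d1]
      by (simp add: h_def)
    then show ?thesis
      using hom(2) ar ob by simp
  qed
  have wh: "w0 \<cdot> h = w"
  proof -
    have "w0 \<cdot> h = ((SigM T i1 \<cdot> SigM T p1) \<boxplus> ((SigM T j1 \<cdot> SigM T q1) \<boxplus>
        ((SigM T d1 \<cdot> SigM T u) \<boxplus> (w \<cdot> d3)))) \<cdot> w"
      using ar ob e(1-3) e'(1-3) k(1-3) rel(6,12) z0 comp_eq_comp[OF e(5), of p3]
        comp_eq_comp[OF e'(5), of q3] comp_eq_comp[OF zE0(2), of d2] comp_eq_comp[OF k(4), of w]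
      by (simp add: h_def)
    then show ?thesis
      using hom(1) ar ob by simp
  qed
  show ?thesis
  proof (rule Exact_of_comparison[OF E0 S zero(1) _ _ _ hv wh])
    show "h \<in> Hom T (Cod T v) (Cod T v0)"
      using ar e e' k by (simp add: h_def in_Hom_iff)
    fix z assume "z \<in> Ar T" "Cod T z = Dom T w" "w \<cdot> z = HZero T (Dom T z) (Cod T w)"
    then have z: "z \<in> Ar T" "Cod T z = Z" "w \<cdot> z = HZero T (Dom T z) (SigO T X)"
      using ar by simp_all
    have zob: "Dom T z \<in> Ob T"
      using z by simp
    have "c \<cdot> (p3 \<cdot> z) = HZero T (Dom T z) (SigO T A)"
      using comp_eq_comp[OF rel(6)[symmetric], of z] z zob ar ob by simp
    then obtain y where y: "y \<in> Ar T" "Dom T y = Dom T z" "Cod T y = B" "b \<cdot> y = p3 \<cdot> z"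
      using Exact_lift2[OF E, of "p3 \<cdot> z"] z ar by auto
    have "c' \<cdot> (q3 \<cdot> z) = HZero T (Dom T z) (SigO T A')"
      using comp_eq_comp[OF rel(12)[symmetric], of z] z zob ar ob by simp
    then obtain y' where y': "y' \<in> Ar T" "Dom T y' = Dom T z" "Cod T y' = B'" "b' \<cdot> y' = q3 \<cdot> z"
      using Exact_lift2[OF E', of "q3 \<cdot> z"] z ar by auto
    \<comment> \<open>Lift the two components of \<open>z\<close> inside the exact triangles and
      correct by the homotopy. The term d3 w z vanishes, so the third identity yields v s = z. The
      lift of \<open>x\<close> along \<open>w\<close> below is the same argument one degree further,
      where \<Sigma>d1 \<Sigma>u x vanishes.\<close>
    define s where "s = (i2 \<cdot> y) \<boxplus> ((j2 \<cdot> y') \<boxplus> (d2 \<cdot> z))"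
    have s: "s \<in> Hom T (Dom T z) (Dom T v)"
      using y y' z ar by (simp add: s_def in_Hom_iff)
    have "v \<cdot> s = ((i3 \<cdot> p3) \<boxplus> ((j3 \<cdot> q3) \<boxplus> ((v \<cdot> d2) \<boxplus> (d3 \<cdot> w)))) \<cdot> z"
      using y y' z ar ob zob comp_eq_comp[OF rel(2)[symmetric], of y]
        comp_eq_comp[OF rel(8)[symmetric], of y']
      by (simp add: s_def)
    also have "\<dots> = z"
      using hom(3) z ob by simp
    finally show "\<exists>y \<in> Hom T (Dom T z) (Dom T v). v \<cdot> y = z"
      using s by blast
  next
    fix x assume "x \<in> Ar T" "Cod T x = SigO T (Dom T u)"
      "SigM T u \<cdot> x = HZero T (Dom T x) (SigO T (Cod T u))"
    then have x: "x \<in> Ar T" "Cod T x = SigO T X" "SigM T u \<cdot> x = HZero T (Dom T x) (SigO T Y)"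
      using ar by simp_all
    have xob: "Dom T x \<in> Ob T"
      using x by simp
    have "SigM T a \<cdot> (SigM T p1 \<cdot> x) = HZero T (Dom T x) (SigO T B)"
      using comp_eq_comp[OF relS(1)[symmetric], of x] x xob ar ob by simp
    then obtain y where y: "y \<in> Ar T" "Dom T y = Dom T x" "Cod T y = C" "c \<cdot> y = SigM T p1 \<cdot> x"
      using Exact_lift3[OF E, of "SigM T p1 \<cdot> x"] x ar by auto
    have "SigM T a' \<cdot> (SigM T q1 \<cdot> x) = HZero T (Dom T x) (SigO T B')"
      using comp_eq_comp[OF relS(2)[symmetric], of x] x xob ar ob by simp
    then obtain y' where y': "y' \<in> Ar T" "Dom T y' = Dom T x" "Cod T y' = C'"
      "c' \<cdot> y' = SigM T q1 \<cdot> x"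
      using Exact_lift3[OF E', of "SigM T q1 \<cdot> x"] x ar by auto
    define s where "s = (i3 \<cdot> y) \<boxplus> ((j3 \<cdot> y') \<boxplus> (d3 \<cdot> x))"
    have s: "s \<in> Hom T (Dom T x) (Dom T w)"
      using y y' x ar by (simp add: s_def in_Hom_iff)
    have "w \<cdot> s = ((SigM T i1 \<cdot> SigM T p1) \<boxplus> ((SigM T j1 \<cdot> SigM T q1) \<boxplus>
        ((SigM T d1 \<cdot> SigM T u) \<boxplus> (w \<cdot> d3)))) \<cdot> x"
      using y y' x ar ob xob comp_eq_comp[OF rel(3)[symmetric], of y]
        comp_eq_comp[OF rel(9)[symmetric], of y']
      by (simp add: s_def)
    also have "\<dots> = x"
      using hom(1) x ob by simp
    finally show "\<exists>z \<in> Hom T (Dom T x) (Dom T w). w \<cdot> z = x"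
      using s by blast
  qed
qed

end

section \<open>Direct sums of triangles\<close>

context additive_category
begin

lemma biproduct_simps:
  assumes "is_biproduct A X Y W i1 i2 p1 p2"
  shows "X \<in> Ob A" "Y \<in> Ob A" "W \<in> Ob A"
    and "i1 \<in> Ar A" "i2 \<in> Ar A" "p1 \<in> Ar A" "p2 \<in> Ar A"
    and "Dom A i1 = X" "Dom A i2 = Y" "Dom A p1 = W" "Dom A p2 = W"
    and "Cod A i1 = W" "Cod A i2 = W" "Cod A p1 = X" "Cod A p2 = Y"
    and "p1 \<cdot> i1 = Ide A X" "p2 \<cdot> i2 = Ide A Y"
    and "p1 \<cdot> i2 = HZero A Y X" "p2 \<cdot> i1 = HZero A X Y"
    and "(i1 \<cdot> p1) \<boxplus> (i2 \<cdot> p2) = Ide A W" "(i2 \<cdot> p2) \<boxplus> (i1 \<cdot> p1) = Ide A W"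
    and "\<And>f. \<lbrakk>f \<in> Ar A; Cod A f = X\<rbrakk> \<Longrightarrow> p1 \<cdot> (i1 \<cdot> f) = f"
    and "\<And>f. \<lbrakk>f \<in> Ar A; Cod A f = Y\<rbrakk> \<Longrightarrow> p2 \<cdot> (i2 \<cdot> f) = f"
    and "\<And>f. \<lbrakk>f \<in> Ar A; Cod A f = Y\<rbrakk> \<Longrightarrow> p1 \<cdot> (i2 \<cdot> f) = HZero A (Dom A f) X"
    and "\<And>f. \<lbrakk>f \<in> Ar A; Cod A f = X\<rbrakk> \<Longrightarrow> p2 \<cdot> (i1 \<cdot> f) = HZero A (Dom A f) Y"
proof -
  show ob: "X \<in> Ob A" "Y \<in> Ob A" "W \<in> Ob A"
    using assms unfolding is_biproduct_def in_Hom_iff by auto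
  show ar: "i1 \<in> Ar A" "i2 \<in> Ar A" "p1 \<in> Ar A" "p2 \<in> Ar A"
    "Dom A i1 = X" "Dom A i2 = Y" "Dom A p1 = W" "Dom A p2 = W"
    "Cod A i1 = W" "Cod A i2 = W" "Cod A p1 = X" "Cod A p2 = Y"
    using assms unfolding is_biproduct_def in_Hom_iff by simp_all
  show eq: "p1 \<cdot> i1 = Ide A X" "p2 \<cdot> i2 = Ide A Y" "p1 \<cdot> i2 = HZero A Y X" "p2 \<cdot> i1 = HZero A X Y"
    "(i1 \<cdot> p1) \<boxplus> (i2 \<cdot> p2) = Ide A W"
    using assms unfolding is_biproduct_def by simp_all
  have "(i2 \<cdot> p2) \<boxplus> (i1 \<cdot> p1) = (i1 \<cdot> p1) \<boxplus> (i2 \<cdot> p2)"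
    by (rule HAdd_commute) (simp_all add: ar)
  then show "(i2 \<cdot> p2) \<boxplus> (i1 \<cdot> p1) = Ide A W"
    using eq(5) by simp
  fix f
  show "p1 \<cdot> (i1 \<cdot> f) = f" "p2 \<cdot> (i1 \<cdot> f) = HZero A (Dom A f) Y" if "f \<in> Ar A" "Cod A f = X"
    using that ar ob comp_eq_comp[OF eq(1), of f] comp_eq_comp[OF eq(4), of f] by simp_all
  show "p2 \<cdot> (i2 \<cdot> f) = f" "p1 \<cdot> (i2 \<cdot> f) = HZero A (Dom A f) X" if "f \<in> Ar A" "Cod A f = Y"
    using that ar ob comp_eq_comp[OF eq(2), of f] comp_eq_comp[OF eq(3), of f] by simp_all
qed

end

context triangulated_category
begin

lemma sequence_map_zero:
  assumes "is_sequence T (a, b, c)" "is_sequence T (u, v, w)"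
  shows "sequence_map T (a, b, c) (u, v, w)
    (HZero T (Dom T a) (Dom T u), HZero T (Dom T b) (Dom T v), HZero T (Dom T c) (Dom T w))"
  using assms unfolding sequence_map_iff[OF assms] is_sequence_iff by simp

text \<open>The case of one triangle: the second is the first again, with zero maps in both
  directions. A contractible summand of the sequence is accounted for by the homotopy and needs no
  triangle of its own.\<close>

lemma Exact_homotopy_retract:
  assumes E: "(a, b, c) \<in> Exact T"
    and S: "is_sequence T (u, v, w)"
    and maps: "sequence_map T (a, b, c) (u, v, w) (i1, i2, i3)"
      "sequence_map T (u, v, w) (a, b, c) (p1, p2, p3)"
    and zero: "v \<cdot> u = HZero T (Dom T u) (Cod T v)" "w \<cdot> v = HZero T (Dom T v) (Cod T w)"
      "SigM T u \<cdot> w = HZero T (Dom T w) (SigO T (Cod T u))"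
    and d: "d1 \<in> Hom T (Dom T v) (Dom T u)" "d2 \<in> Hom T (Dom T w) (Dom T v)"
      "d3 \<in> Hom T (Cod T w) (Dom T w)"
    and homotopy: "(SigM T i1 \<cdot> SigM T p1) \<boxplus> ((SigM T d1 \<cdot> SigM T u) \<boxplus> (w \<cdot> d3))
        = Ide T (Cod T w)"
      "(i2 \<cdot> p2) \<boxplus> ((u \<cdot> d1) \<boxplus> (d2 \<cdot> v)) = Ide T (Dom T v)"
      "(i3 \<cdot> p3) \<boxplus> ((v \<cdot> d2) \<boxplus> (d3 \<cdot> w)) = Ide T (Dom T w)"
  shows "(u, v, w) \<in> Exact T"
proof -
  note seqE = Exact_is_sequence[OF E]
  have ar: "a \<in> Ar T" "b \<in> Ar T" "c \<in> Ar T" "u \<in> Ar T" "v \<in> Ar T" "w \<in> Ar T"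
    "Cod T u = Dom T v" "Cod T v = Dom T w" "Cod T w = SigO T (Dom T u)"
    using seqE S unfolding is_sequence_iff by simp_all
  show ?thesis
    by (rule Exact_homotopy_retract2[OF E E S maps sequence_map_zero[OF seqE S]
          sequence_map_zero[OF S seqE] zero d])
      (use homotopy d ar in \<open>simp_all add: in_Hom_iff\<close>)
qed

text \<open>The sequence is contractible through \<open>p1\<close> and \<open>i2\<close>. Hence it
  is a retract up to homotopy of any exact triangle by zero maps, and the triangle on an identity is
  taken.\<close>

lemma Exact_biproduct:
  assumes "is_biproduct T X Y W i1 i2 p1 p2"
  shows "(i1, p2, HZero T Y (SigO T X)) \<in> Exact T"
proof -
  note b = biproduct_simps[OF assms]
  obtain v w where E: "(Ide T X, v, w) \<in> Exact T"
    using Exact_extend[of "Ide T X"] b by auto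
  note seqE = Exact_is_sequence[OF E]
  have S: "is_sequence T (i1, p2, HZero T Y (SigO T X))"
    by (simp add: is_sequence_iff b)
  note sb = biproduct_simps[OF Sigma_biproduct[OF assms]]
  show ?thesis
    by (rule Exact_homotopy_retract[OF E S sequence_map_zero[OF seqE S] sequence_map_zero[OF S seqE],
          where ?d1.0 = p1 and ?d2.0 = i2 and ?d3.0 = "HZero T (SigO T X) Y"])
      (use Exact_arrows[OF E] in \<open>simp_all add: in_Hom_iff b sb\<close>)
qed

text \<open>The isomorphism is (1, -1, 1). It is needed because a mapping cone negates all three
  arrows of the source triangle, while a rotation negates only one.\<close>

lemma Exact_hneg12:
  assumes "(u, v, w) \<in> Exact T"
  shows "(hneg T u, hneg T v, w) \<in> Exact T"
proof -
  note u = Exact_arrows[OF assms]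
  have ob: "Dom T u \<in> Ob T" "Dom T v \<in> Ob T" "Dom T w \<in> Ob T"
    using u by simp_all
  have "is_sequence T (hneg T u, hneg T v, w)"
    using u by (simp add: is_sequence_iff)
  from sequence_map_iff[OF Exact_is_sequence[OF assms] this]
  have "sequence_map T (u, v, w) (hneg T u, hneg T v, w)
    (Ide T (Dom T u), hneg T (Ide T (Dom T v)), Ide T (Dom T w))"
    using u ob by simp
  then show ?thesis
    using Exact_iso_closed[OF assms] is_iso_Ide is_iso_hneg_Ide ob by blast
qed

end

text \<open>A direct sum of triangles, recorded by the relations of its arrows with the injections
  and projections rather than by a diagonal formula for \<open>U\<close>, \<open>V\<close>,
  \<open>W\<close>. So the decomposition can be changed while the triangle stays fixed, as in
  \<open>shear\<close>.\<close>

locale triangle_biproduct = triangulated_category T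
  for T :: "('o, 'm, 'x) tri_cat_scheme" (structure) +
  fixes X Y Z X' Y' Z' A B D :: 'o
    and u v w u' v' w' U V W :: 'm
    and i1 i2 i3 j1 j2 j3 p1 p2 p3 q1 q2 q3 :: 'm
  assumes Exact1: "(u, v, w) \<in> Exact T" and Exact2: "(u', v', w') \<in> Exact T"
    and Exact3: "(U, V, W) \<in> Exact T"
    and objects: "Dom T u = X" "Dom T v = Y" "Dom T w = Z"
      "Dom T u' = X'" "Dom T v' = Y'" "Dom T w' = Z'"
      "Dom T U = A" "Dom T V = B" "Dom T W = D"
    and biproduct1: "is_biproduct T X X' A i1 j1 p1 q1"
    and biproduct2: "is_biproduct T Y Y' B i2 j2 p2 q2"
    and biproduct3: "is_biproduct T Z Z' D i3 j3 p3 q3"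
    and injection1: "U \<cdot> i1 = i2 \<cdot> u" "V \<cdot> i2 = i3 \<cdot> v" "W \<cdot> i3 = SigM T i1 \<cdot> w"
    and injection2: "U \<cdot> j1 = j2 \<cdot> u'" "V \<cdot> j2 = j3 \<cdot> v'" "W \<cdot> j3 = SigM T j1 \<cdot> w'"
    and projection1: "p2 \<cdot> U = u \<cdot> p1" "p3 \<cdot> V = v \<cdot> p2" "SigM T p1 \<cdot> W = w \<cdot> p3"
    and projection2: "q2 \<cdot> U = u' \<cdot> q1" "q3 \<cdot> V = v' \<cdot> q2" "SigM T q1 \<cdot> W = w' \<cdot> q3"
begin

lemmas biproducts [simp] =
  biproduct_simps[OF biproduct1] biproduct_simps[OF biproduct2] biproduct_simps[OF biproduct3]
  biproduct_simps[OF Sigma_biproduct[OF biproduct1]]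
  biproduct_simps[OF Sigma_biproduct[OF biproduct2]]
  biproduct_simps[OF Sigma_biproduct[OF biproduct3]]

lemmas arrows [simp] = objects Exact_arrows[OF Exact1, unfolded objects]
  Exact_arrows[OF Exact2, unfolded objects] Exact_arrows[OF Exact3, unfolded objects]

lemmas zeros =
  Exact_comp_zero[OF Exact1, unfolded arrows] Exact_comp_zero[OF Exact2, unfolded arrows]
  Exact_comp_zero[OF Exact3, unfolded arrows]

text \<open>Read from left to right, the equations trade an arrow of the sum next to an injection or
  projection for an arrow of a summand. Composites thereby normalise to expressions in the two
  summands, where \<open>zeros\<close> applies.\<close>

lemmas relations [simp] = injection1 injection2 projection1 projection2 zeros

lemmas relations_shifted [simp] =
  injection1(1,2)[THEN Sigma_comp_eq, simplified] injection2(1,2)[THEN Sigma_comp_eq, simplified]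
  projection1(1,2)[THEN Sigma_comp_eq, simplified] projection2(1,2)[THEN Sigma_comp_eq, simplified]
  zeros(1,2,4,5,7,8)[THEN Sigma_comp_eq, simplified]

lemmas relations_assoc [simp] =
  relations[THEN comp_eq_comp, simplified] relations_shifted[THEN comp_eq_comp, simplified]

end

text \<open>For the diagonal arrows the injections and projections already decompose the identity in
  every degree, so the homotopy can be zero.\<close>

lemma (in triangulated_category) Exact_direct_sum:
  assumes E: "(u, v, w) \<in> Exact T" and E': "(u', v', w') \<in> Exact T"
  shows "\<exists>A B D U V W i1 i2 i3 j1 j2 j3 p1 p2 p3 q1 q2 q3.
    triangle_biproduct T (Dom T u) (Dom T v) (Dom T w) (Dom T u') (Dom T v') (Dom T w') A B D
      u v w u' v' w' U V W i1 i2 i3 j1 j2 j3 p1 p2 p3 q1 q2 q3"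
proof -
  define X Y Z where "X = Dom T u" "Y = Dom T v" "Z = Dom T w"
  define X' Y' Z' where "X' = Dom T u'" "Y' = Dom T v'" "Z' = Dom T w'"
  note defs = X_Y_Z_def X'_Y'_Z'_def
  have ar: "u \<in> Ar T" "v \<in> Ar T" "w \<in> Ar T" "u' \<in> Ar T" "v' \<in> Ar T" "w' \<in> Ar T"
    "Dom T u = X" "Cod T u = Y" "Dom T v = Y" "Cod T v = Z" "Dom T w = Z" "Cod T w = SigO T X"
    "Dom T u' = X'" "Cod T u' = Y'" "Dom T v' = Y'" "Cod T v' = Z'" "Dom T w' = Z'"
    "Cod T w' = SigO T X'"
    using Exact_arrows[OF E] Exact_arrows[OF E'] by (simp_all add: defs)
  have ob: "X \<in> Ob T" "Y \<in> Ob T" "Z \<in> Ob T" "X' \<in> Ob T" "Y' \<in> Ob T" "Z' \<in> Ob T"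
    using ar(1-6) by (simp_all add: defs)
  obtain A i1 j1 p1 q1 where b1: "is_biproduct T X X' A i1 j1 p1 q1"
    using ex_biproduct ob by blast
  obtain B i2 j2 p2 q2 where b2: "is_biproduct T Y Y' B i2 j2 p2 q2"
    using ex_biproduct ob by blast
  obtain D i3 j3 p3 q3 where b3: "is_biproduct T Z Z' D i3 j3 p3 q3"
    using ex_biproduct ob by blast
  note b = biproduct_simps[OF b1] biproduct_simps[OF b2] biproduct_simps[OF b3]
    biproduct_simps[OF Sigma_biproduct[OF b1]] biproduct_simps[OF Sigma_biproduct[OF b2]]
    biproduct_simps[OF Sigma_biproduct[OF b3]]
  note zero = Exact_comp_zero[OF E, unfolded ar] Exact_comp_zero[OF E', unfolded ar]
  note zero' = zero[THEN comp_eq_comp]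
  define U where "U = (i2 \<cdot> (u \<cdot> p1)) \<boxplus> (j2 \<cdot> (u' \<cdot> q1))"
  define V where "V = (i3 \<cdot> (v \<cdot> p2)) \<boxplus> (j3 \<cdot> (v' \<cdot> q2))"
  define W where "W = (SigM T i1 \<cdot> (w \<cdot> p3)) \<boxplus> (SigM T j1 \<cdot> (w' \<cdot> q3))"
  have arU: "U \<in> Ar T" "V \<in> Ar T" "W \<in> Ar T" "Dom T U = A" "Cod T U = B" "Dom T V = B"
    "Cod T V = D" "Dom T W = D" "Cod T W = SigO T A"
    by (simp_all add: U_def V_def W_def ar b)
  have S: "is_sequence T (U, V, W)"
    by (simp add: is_sequence_iff arU)
  have injection1: "U \<cdot> i1 = i2 \<cdot> u" "V \<cdot> i2 = i3 \<cdot> v" "W \<cdot> i3 = SigM T i1 \<cdot> w"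
    and injection2: "U \<cdot> j1 = j2 \<cdot> u'" "V \<cdot> j2 = j3 \<cdot> v'" "W \<cdot> j3 = SigM T j1 \<cdot> w'"
    and projection1: "p2 \<cdot> U = u \<cdot> p1" "p3 \<cdot> V = v \<cdot> p2" "SigM T p1 \<cdot> W = w \<cdot> p3"
    and projection2: "q2 \<cdot> U = u' \<cdot> q1" "q3 \<cdot> V = v' \<cdot> q2" "SigM T q1 \<cdot> W = w' \<cdot> q3"
    by (simp_all add: U_def V_def W_def ar b ob)
  note seqE = Exact_is_sequence[OF E] and seqE' = Exact_is_sequence[OF E']
  have maps: "sequence_map T (u, v, w) (U, V, W) (i1, i2, i3)"
    "sequence_map T (U, V, W) (u, v, w) (p1, p2, p3)"
    "sequence_map T (u', v', w') (U, V, W) (j1, j2, j3)"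
    "sequence_map T (U, V, W) (u', v', w') (q1, q2, q3)"
    unfolding sequence_map_iff[OF seqE S] sequence_map_iff[OF S seqE]
      sequence_map_iff[OF seqE' S] sequence_map_iff[OF S seqE']
    by (simp_all add: injection1 injection2 projection1 projection2 ar arU b)
  have zeroS: "V \<cdot> U = HZero T A D" "W \<cdot> V = HZero T B (SigO T A)"
    "SigM T U \<cdot> W = HZero T D (SigO T B)"
    by (simp_all add: U_def V_def W_def ar b ob zero')
  have "(U, V, W) \<in> Exact T"
    by (rule Exact_homotopy_retract2[OF E E' S maps,
          where ?d1.0 = "HZero T B A" and ?d2.0 = "HZero T D B" and ?d3.0 = "HZero T (SigO T A) D"])
      (simp_all add: zeroS in_Hom_iff arU b)
  then have "triangle_biproduct T X Y Z X' Y' Z' A B D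
      u v w u' v' w' U V W i1 i2 i3 j1 j2 j3 p1 p2 p3 q1 q2 q3"
    using E E' ar arU b1 b2 b3 injection1 injection2 projection1 projection2
    by unfold_locales simp_all
  then show ?thesis
    unfolding defs by blast
qed

context triangle_biproduct
begin

lemma sequence_maps:
  "sequence_map T (u, v, w) (U, V, W) (i1, i2, i3)"
  "sequence_map T (U, V, W) (u', v', w') (q1, q2, q3)"
  unfolding sequence_map_iff[OF Exact_is_sequence[OF Exact1] Exact_is_sequence[OF Exact3]]
    sequence_map_iff[OF Exact_is_sequence[OF Exact3] Exact_is_sequence[OF Exact2]]
  by simp_all

text \<open>This is the change of decomposition by the automorphism with matrix rows (1, 0) and
  (\<phi>, 1). The new first injection is (1, \<phi>), so whatever holds for injections of summands
  holds for it; compatibility with \<open>U\<close>, \<open>V\<close>, \<open>W\<close> is exactly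
  that (f, g, h) is a map of triangles.\<close>

lemma shear:
  assumes "sequence_map T (u, v, w) (u', v', w') (f, g, h)"
  shows "triangle_biproduct T X Y Z X' Y' Z' A B D u v w u' v' w' U V W
    (i1 \<boxplus> (j1 \<cdot> f)) (i2 \<boxplus> (j2 \<cdot> g)) (i3 \<boxplus> (j3 \<cdot> h)) j1 j2 j3 p1 p2 p3
    (q1 \<boxplus> hneg T (f \<cdot> p1)) (q2 \<boxplus> hneg T (g \<cdot> p2)) (q3 \<boxplus> hneg T (h \<cdot> p3))"
proof -
  note m = assms[unfolded sequence_map_iff[OF Exact_is_sequence[OF Exact1]
        Exact_is_sequence[OF Exact2]]]
  have ar: "f \<in> Ar T" "g \<in> Ar T" "h \<in> Ar T" "Dom T f = X" "Cod T f = X'"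
    "Dom T g = Y" "Cod T g = Y'" "Dom T h = Z" "Cod T h = Z'"
    using m by simp_all
  have eq: "u' \<cdot> f = g \<cdot> u" "v' \<cdot> g = h \<cdot> v" "w' \<cdot> h = SigM T f \<cdot> w"
    using m by simp_all
  note eq' = eq[THEN comp_eq_comp]
  have bip: "is_biproduct T O1 O2 P (i \<boxplus> (j \<cdot> k)) j p (q \<boxplus> hneg T (k \<cdot> p))"
    if b: "is_biproduct T O1 O2 P i j p q" and k: "k \<in> Ar T" "Dom T k = O1" "Cod T k = O2"
    for O1 O2 P i j p q k
  proof -
    note b' = biproduct_simps[OF b]
    \<comment> \<open>The two terms j k p cancel. The rules that turn the sum of projectors into an
      identity are withheld so that both sides remain sums.\<close>
    have "((i \<boxplus> (j \<cdot> k)) \<cdot> p) \<boxplus> (j \<cdot> (q \<boxplus> hneg T (k \<cdot> p))) = (i \<cdot> p) \<boxplus> (j \<cdot> q)"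
      using k by (simp add: b' HAdd_ac del: b'(20,21))
    then show ?thesis
      using k by (simp add: is_biproduct_def in_Hom_iff b')
  qed
  show ?thesis
    by unfold_locales
      (simp_all add: Exact1 Exact2 Exact3 bip biproduct1 biproduct2 biproduct3 ar eq eq')
qed

end

section \<open>Mapping cones of inclusions and projections\<close>

lemma (in additive_category) matrix_map_simps:
  assumes "is_biproduct A X Y P i1 i2 p1 p2" "is_biproduct A X' Y' Q j1 j2 q1 q2"
    and "a \<in> Hom A X X'" "b \<in> Hom A Y X'" "c \<in> Hom A X Y'" "d \<in> Hom A Y Y'"
  defines "M \<equiv> matrix_map A j1 j2 a b c d p1 p2"
  shows "M \<in> Ar A" "Dom A M = P" "Cod A M = Q"
    and "M \<cdot> i1 = (j1 \<cdot> a) \<boxplus> (j2 \<cdot> c)" "M \<cdot> i2 = (j1 \<cdot> b) \<boxplus> (j2 \<cdot> d)"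
    and "q1 \<cdot> M = (a \<cdot> p1) \<boxplus> (b \<cdot> p2)" "q2 \<cdot> M = (c \<cdot> p1) \<boxplus> (d \<cdot> p2)"
  using biproduct_simps[OF assms(1)] biproduct_simps[OF assms(2)] assms(3-6)
  unfolding M_def matrix_map_def in_Hom_iff by simp_all

context triangle_biproduct
begin

text \<open>The auxiliary triangles of the octahedra: an inclusion has the complement as its cone, a
  projection the shift of its kernel, with the sign that rotation imposes.\<close>

lemma Exact_splittings:
  "(i1, q1, HZero T X' (SigO T X)) \<in> Exact T"
  "(i2, q2, HZero T Y' (SigO T Y)) \<in> Exact T"
  "(q1, HZero T X' (SigO T X), hneg T (SigM T i1)) \<in> Exact T"
  "(q2, HZero T Y' (SigO T Y), hneg T (SigM T i2)) \<in> Exact T"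
  using Exact_biproduct[OF biproduct1] Exact_biproduct[OF biproduct2] Exact_rotate1 by blast+

text \<open>The mapping cone is the sum of the second triangle and the cone of the identity of the
  first, and the latter is contractible.\<close>

lemma good_injection: "good T (u, v, w) (U, V, W) (i1, i2, i3)"
proof -
  obtain W1 I1 I2 P1 P2 where b1: "is_biproduct T A Y W1 I1 I2 P1 P2"
    using ex_biproduct[of A Y] by auto
  obtain W2 J1 J2 Q1 Q2 where b2: "is_biproduct T B Z W2 J1 J2 Q1 Q2"
    using ex_biproduct[of B Z] by auto
  obtain W3 K1 K2 R1 R2 where b3: "is_biproduct T D (SigO T X) W3 K1 K2 R1 R2"
    using ex_biproduct[of D "SigO T X"] by auto
  note b4 = Sigma_biproduct[OF b1]
  note b = biproduct_simps(4-)[OF b1] biproduct_simps(4-)[OF b2] biproduct_simps(4-)[OF b3]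
    biproduct_simps(4-)[OF b4] biproduct_simps(3)[OF b1] biproduct_simps(3)[OF b2]
    biproduct_simps(3)[OF b3]
  define M1 where "M1 = matrix_map T J1 J2 U i2 (HZero T A Z) (hneg T v) P1 P2"
  define M2 where "M2 = matrix_map T K1 K2 V i3 (HZero T B (SigO T X)) (hneg T w) Q1 Q2"
  define M3 where "M3 = matrix_map T (SigM T I1) (SigM T I2) W (SigM T i1)
    (HZero T D (SigO T Y)) (hneg T (SigM T u)) R1 R2"
  have ar: "M1 \<in> Ar T" "Dom T M1 = W1" "Cod T M1 = W2" "M2 \<in> Ar T" "Dom T M2 = W2" "Cod T M2 = W3"
    "M3 \<in> Ar T" "Dom T M3 = W3" "Cod T M3 = SigO T W1"
    unfolding M1_def M2_def M3_def
    by (rule matrix_map_simps[OF b1 b2] matrix_map_simps[OF b2 b3] matrix_map_simps[OF b3 b4];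
        simp add: in_Hom_iff)+
  have M: "M1 \<cdot> I1 = J1 \<cdot> U" "M1 \<cdot> I2 = (J1 \<cdot> i2) \<boxplus> hneg T (J2 \<cdot> v)"
    "Q1 \<cdot> M1 = (U \<cdot> P1) \<boxplus> (i2 \<cdot> P2)" "Q2 \<cdot> M1 = hneg T (v \<cdot> P2)"
    "M2 \<cdot> J1 = K1 \<cdot> V" "M2 \<cdot> J2 = (K1 \<cdot> i3) \<boxplus> hneg T (K2 \<cdot> w)"
    "R1 \<cdot> M2 = (V \<cdot> Q1) \<boxplus> (i3 \<cdot> Q2)" "R2 \<cdot> M2 = hneg T (w \<cdot> Q2)"
    "M3 \<cdot> K1 = SigM T I1 \<cdot> W" "M3 \<cdot> K2 = (SigM T I1 \<cdot> SigM T i1) \<boxplus> hneg T (SigM T I2 \<cdot> SigM T u)"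
    "SigM T P1 \<cdot> M3 = (W \<cdot> R1) \<boxplus> (SigM T i1 \<cdot> R2)" "SigM T P2 \<cdot> M3 = hneg T (SigM T u \<cdot> R2)"
    unfolding M1_def M2_def M3_def
    by (subst matrix_map_simps[OF b1 b2] matrix_map_simps[OF b2 b3] matrix_map_simps[OF b3 b4];
        simp add: in_Hom_iff b)+
  note SM = M(1-4)[THEN Sigma_comp_eq]
  note rules = ar b M M[THEN comp_eq_comp] SM SM[THEN comp_eq_comp]
  have S: "is_sequence T (M1, M2, M3)"
    by (simp add: is_sequence_iff ar)
  note seq = Exact_is_sequence[OF Exact2]
  have maps: "sequence_map T (u', v', w') (M1, M2, M3) (I1 \<cdot> j1, J1 \<cdot> j2, K1 \<cdot> j3)"
    "sequence_map T (M1, M2, M3) (u', v', w') (q1 \<cdot> P1, q2 \<cdot> Q1, q3 \<cdot> R1)"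
    unfolding sequence_map_iff[OF seq S] sequence_map_iff[OF S seq] by (simp_all add: rules)
  have "M2 \<cdot> M1 = HZero T W1 W3"
    by (rule biproduct_eqI[OF b3]; simp add: rules)
  moreover have "M3 \<cdot> M2 = HZero T W2 (SigO T W1)"
    by (rule biproduct_eqI[OF b4]; simp add: rules)
  moreover have "SigM T M1 \<cdot> M3 = HZero T W3 (SigO T W2)"
    by (rule biproduct_eqI[OF Sigma_biproduct[OF b2]]; simp add: rules)
  moreover
  \<comment> \<open>The homotopy consists of the left inverses \<open>p2\<close>, \<open>p3\<close>,
    \<Sigma>p1 of the entries \<open>i2\<close>, \<open>i3\<close>, \<Sigma>i1 of the cone, each run
    backwards between the same two summands.\<close>
  define d1 where "d1 = I2 \<cdot> (p2 \<cdot> Q1)"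
  define d2 where "d2 = J2 \<cdot> (p3 \<cdot> R1)"
  define d3 where "d3 = K2 \<cdot> (SigM T p1 \<cdot> SigM T P1)"
  have d: "d1 \<in> Ar T" "Dom T d1 = W2" "Cod T d1 = W1" "d2 \<in> Ar T" "Dom T d2 = W3" "Cod T d2 = W2"
    "d3 \<in> Ar T" "Dom T d3 = SigO T W1" "Cod T d3 = W3"
    by (simp_all add: d1_def d2_def d3_def b)
  have "(SigM T (I1 \<cdot> j1) \<cdot> SigM T (q1 \<cdot> P1)) \<boxplus> ((SigM T d1 \<cdot> SigM T M1) \<boxplus> (M3 \<cdot> d3))
      = Ide T (SigO T W1)"
  proof (rule biproduct_eqI[OF b4])
    let ?f = "(SigM T (I1 \<cdot> j1) \<cdot> SigM T (q1 \<cdot> P1)) \<boxplus> ((SigM T d1 \<cdot> SigM T M1) \<boxplus> (M3 \<cdot> d3))"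
    show "SigM T P1 \<cdot> ?f = SigM T P1 \<cdot> Ide T (SigO T W1)"
      by (rule biproduct_eqI'[OF b4]; simp add: rules d1_def d3_def)
    show "SigM T P2 \<cdot> ?f = SigM T P2 \<cdot> Ide T (SigO T W1)"
      by (rule biproduct_eqI'[OF b4]; simp add: rules d1_def d3_def)
  qed (simp_all add: rules d)
  moreover
  have "((J1 \<cdot> j2) \<cdot> (q2 \<cdot> Q1)) \<boxplus> ((M1 \<cdot> d1) \<boxplus> (d2 \<cdot> M2)) = Ide T W2" (is "?f = _")
  proof (rule biproduct_eqI[OF b2])
    show "Q1 \<cdot> ?f = Q1 \<cdot> Ide T W2" "Q2 \<cdot> ?f = Q2 \<cdot> Ide T W2"
      by (rule biproduct_eqI'[OF b2]; simp add: rules d1_def d2_def)+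
  qed (simp_all add: rules d)
  moreover
  have "((K1 \<cdot> j3) \<cdot> (q3 \<cdot> R1)) \<boxplus> ((M2 \<cdot> d2) \<boxplus> (d3 \<cdot> M3)) = Ide T W3" (is "?f = _")
  proof (rule biproduct_eqI[OF b3])
    show "R1 \<cdot> ?f = R1 \<cdot> Ide T W3" "R2 \<cdot> ?f = R2 \<cdot> Ide T W3"
      by (rule biproduct_eqI'[OF b3]; simp add: rules d2_def d3_def)+
  qed (simp_all add: rules d)
  ultimately have "(M1, M2, M3) \<in> Exact T"
    by (intro Exact_homotopy_retract[OF Exact2 S maps, of d1 d2 d3])
      (simp_all only: ar d in_Hom_iff simp_thms)
  then show ?thesis
    using b1 b2 b3 unfolding good_def M1_def M2_def M3_def prod.case arrows by blast
qed

text \<open>Here the cone of the identity of the second triangle splits off. What survives is the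
  first triangle, the kernel, rotated once and with all three arrows negated.\<close>

lemma good_projection: "good T (U, V, W) (u', v', w') (q1, q2, q3)"
proof -
  obtain W1 I1 I2 P1 P2 where b1: "is_biproduct T X' B W1 I1 I2 P1 P2"
    using ex_biproduct[of X' B] by auto
  obtain W2 J1 J2 Q1 Q2 where b2: "is_biproduct T Y' D W2 J1 J2 Q1 Q2"
    using ex_biproduct[of Y' D] by auto
  obtain W3 K1 K2 R1 R2 where b3: "is_biproduct T Z' (SigO T A) W3 K1 K2 R1 R2"
    using ex_biproduct[of Z' "SigO T A"] by auto
  note b4 = Sigma_biproduct[OF b1]
  note b = biproduct_simps(4-)[OF b1] biproduct_simps(4-)[OF b2] biproduct_simps(4-)[OF b3]
    biproduct_simps(4-)[OF b4] biproduct_simps(3)[OF b1] biproduct_simps(3)[OF b2]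
    biproduct_simps(3)[OF b3]
  define M1 where "M1 = matrix_map T J1 J2 u' q2 (HZero T X' D) (hneg T V) P1 P2"
  define M2 where "M2 = matrix_map T K1 K2 v' q3 (HZero T Y' (SigO T A)) (hneg T W) Q1 Q2"
  define M3 where "M3 = matrix_map T (SigM T I1) (SigM T I2) w' (SigM T q1)
    (HZero T Z' (SigO T B)) (hneg T (SigM T U)) R1 R2"
  have ar: "M1 \<in> Ar T" "Dom T M1 = W1" "Cod T M1 = W2" "M2 \<in> Ar T" "Dom T M2 = W2" "Cod T M2 = W3"
    "M3 \<in> Ar T" "Dom T M3 = W3" "Cod T M3 = SigO T W1"
    unfolding M1_def M2_def M3_def
    by (rule matrix_map_simps[OF b1 b2] matrix_map_simps[OF b2 b3] matrix_map_simps[OF b3 b4];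
        simp add: in_Hom_iff)+
  have M: "M1 \<cdot> I1 = J1 \<cdot> u'" "M1 \<cdot> I2 = (J1 \<cdot> q2) \<boxplus> hneg T (J2 \<cdot> V)"
    "Q1 \<cdot> M1 = (u' \<cdot> P1) \<boxplus> (q2 \<cdot> P2)" "Q2 \<cdot> M1 = hneg T (V \<cdot> P2)"
    "M2 \<cdot> J1 = K1 \<cdot> v'" "M2 \<cdot> J2 = (K1 \<cdot> q3) \<boxplus> hneg T (K2 \<cdot> W)"
    "R1 \<cdot> M2 = (v' \<cdot> Q1) \<boxplus> (q3 \<cdot> Q2)" "R2 \<cdot> M2 = hneg T (W \<cdot> Q2)"
    "M3 \<cdot> K1 = SigM T I1 \<cdot> w'" "M3 \<cdot> K2 = (SigM T I1 \<cdot> SigM T q1) \<boxplus> hneg T (SigM T I2 \<cdot> SigM T U)"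
    "SigM T P1 \<cdot> M3 = (w' \<cdot> R1) \<boxplus> (SigM T q1 \<cdot> R2)" "SigM T P2 \<cdot> M3 = hneg T (SigM T U \<cdot> R2)"
    unfolding M1_def M2_def M3_def
    by (subst matrix_map_simps[OF b1 b2] matrix_map_simps[OF b2 b3] matrix_map_simps[OF b3 b4];
        simp add: in_Hom_iff b)+
  note SM = M(1-4)[THEN Sigma_comp_eq]
  note rules = ar b M M[THEN comp_eq_comp] SM SM[THEN comp_eq_comp]
  have S: "is_sequence T (M1, M2, M3)"
    by (simp add: is_sequence_iff ar)
  have E: "(hneg T v, hneg T w, hneg T (SigM T u)) \<in> Exact T"
    by (intro Exact_hneg12 Exact_rotate1 Exact1)
  note seq = Exact_is_sequence[OF E]
  have maps: "sequence_map T (hneg T v, hneg T w, hneg T (SigM T u)) (M1, M2, M3)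
      (I2 \<cdot> i2, J2 \<cdot> i3, K2 \<cdot> SigM T i1)"
    "sequence_map T (M1, M2, M3) (hneg T v, hneg T w, hneg T (SigM T u))
      (p2 \<cdot> P2, p3 \<cdot> Q2, SigM T p1 \<cdot> R2)"
    unfolding sequence_map_iff[OF seq S] sequence_map_iff[OF S seq] by (simp_all add: rules)
  have "M2 \<cdot> M1 = HZero T W1 W3"
    by (rule biproduct_eqI[OF b3]; simp add: rules)
  moreover have "M3 \<cdot> M2 = HZero T W2 (SigO T W1)"
    by (rule biproduct_eqI[OF b4]; simp add: rules)
  moreover have "SigM T M1 \<cdot> M3 = HZero T W3 (SigO T W2)"
    by (rule biproduct_eqI[OF Sigma_biproduct[OF b2]]; simp add: rules)
  moreover
  \<comment> \<open>Now the entries to be inverted are \<open>q2\<close>, \<open>q3\<close>,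
    \<Sigma>q1, and the homotopy consists of their right inverses.\<close>
  define d1 where "d1 = I2 \<cdot> (j2 \<cdot> Q1)"
  define d2 where "d2 = J2 \<cdot> (j3 \<cdot> R1)"
  define d3 where "d3 = K2 \<cdot> (SigM T j1 \<cdot> SigM T P1)"
  have d: "d1 \<in> Ar T" "Dom T d1 = W2" "Cod T d1 = W1" "d2 \<in> Ar T" "Dom T d2 = W3" "Cod T d2 = W2"
    "d3 \<in> Ar T" "Dom T d3 = SigO T W1" "Cod T d3 = W3"
    by (simp_all add: d1_def d2_def d3_def b)
  have "(SigM T (I2 \<cdot> i2) \<cdot> SigM T (p2 \<cdot> P2)) \<boxplus> ((SigM T d1 \<cdot> SigM T M1) \<boxplus> (M3 \<cdot> d3))
      = Ide T (SigO T W1)" (is "?f = _")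
  proof (rule biproduct_eqI[OF b4])
    show "SigM T P1 \<cdot> ?f = SigM T P1 \<cdot> Ide T (SigO T W1)"
      "SigM T P2 \<cdot> ?f = SigM T P2 \<cdot> Ide T (SigO T W1)"
      by (rule biproduct_eqI'[OF b4]; simp add: rules d1_def d3_def)+
  qed (simp_all add: rules d)
  moreover
  have "((J2 \<cdot> i3) \<cdot> (p3 \<cdot> Q2)) \<boxplus> ((M1 \<cdot> d1) \<boxplus> (d2 \<cdot> M2)) = Ide T W2" (is "?f = _")
  proof (rule biproduct_eqI[OF b2])
    show "Q1 \<cdot> ?f = Q1 \<cdot> Ide T W2" "Q2 \<cdot> ?f = Q2 \<cdot> Ide T W2"
      by (rule biproduct_eqI'[OF b2]; simp add: rules d1_def d2_def)+
  qed (simp_all add: rules d)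
  moreover
  have "((K2 \<cdot> SigM T i1) \<cdot> (SigM T p1 \<cdot> R2)) \<boxplus> ((M2 \<cdot> d2) \<boxplus> (d3 \<cdot> M3)) = Ide T W3" (is "?f = _")
  proof (rule biproduct_eqI[OF b3])
    show "R1 \<cdot> ?f = R1 \<cdot> Ide T W3" "R2 \<cdot> ?f = R2 \<cdot> Ide T W3"
      by (rule biproduct_eqI'[OF b3]; simp add: rules d2_def d3_def)+
  qed (simp_all add: rules d)
  ultimately have "(M1, M2, M3) \<in> Exact T"
    by (intro Exact_homotopy_retract[OF E S maps, of d1 d2 d3])
      (simp_all only: ar d in_Hom_iff simp_thms)
  then show ?thesis
    using b1 b2 b3 unfolding good_def M1_def M2_def M3_def prod.case arrows by blast
qed

section \<open>Octahedra for inclusions and projections\<close>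

lemma verdier_good_injection: "verdier_good T (u, v, w) (U, V, W) (i1, i2, i3)"
proof -
  \<comment> \<open>The composite i2 u has components u and 0, so its cone is Z \<oplus> Y': the
    cone of \<open>u\<close> together with the untouched summand. Accordingly \<open>vt\<close> is
    the diagonal map of \<open>v\<close> and 1. The octahedron over \<open>u\<close> and
    \<open>i2\<close> is then the split sequence from Z to Y'.\<close>
  obtain P n1 n2 m1 m2 where b0: "is_biproduct T Z Y' P n1 n2 m1 m2"
    using ex_biproduct[of Z Y'] by auto
  note b = biproduct_simps(3-)[OF b0] biproduct_simps(4-)[OF Sigma_biproduct[OF b0]]
  define vt where "vt = (n1 \<cdot> (v \<cdot> p2)) \<boxplus> (n2 \<cdot> q2)"
  define wt where "wt = w \<cdot> m1"
  \<comment> \<open>These arise from \<open>u'\<close> and \<open>v'\<close> by adding the identity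
    of Z. The choice of \<open>\<beta>2\<close> makes its composite with \<open>vt\<close> equal to
    \<open>V\<close> and its restriction to Z equal to \<open>i3\<close>, the required third
    component.\<close>
  define \<alpha>2 where "\<alpha>2 = n2 \<cdot> u'"
  define \<beta>2 where "\<beta>2 = (i3 \<cdot> m1) \<boxplus> (j3 \<cdot> (v' \<cdot> m2))"
  note defs = vt_def wt_def \<alpha>2_def \<beta>2_def
  have ar: "vt \<in> Ar T" "Dom T vt = B" "Cod T vt = P" "wt \<in> Ar T" "Dom T wt = P"
    "Cod T wt = SigO T X" "\<alpha>2 \<in> Ar T" "Dom T \<alpha>2 = X'" "Cod T \<alpha>2 = P"
    "\<beta>2 \<in> Ar T" "Dom T \<beta>2 = P" "Cod T \<beta>2 = D"
    by (simp_all add: defs b)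
  note rules = b ar in_Hom_iff
  have S: "is_sequence T (i2 \<cdot> u, vt, wt)"
    by (simp add: is_sequence_iff rules)
  have c: "(i2 \<cdot> u, vt, wt) \<in> Exact T"
  proof (rule Exact_homotopy_retract[OF Exact1 S])
    show "sequence_map T (u, v, w) (i2 \<cdot> u, vt, wt) (Ide T X, i2, n1)"
      "sequence_map T (i2 \<cdot> u, vt, wt) (u, v, w) (Ide T X, p2, m1)"
      unfolding sequence_map_iff[OF Exact_is_sequence[OF Exact1] S]
        sequence_map_iff[OF S Exact_is_sequence[OF Exact1]]
      by (simp_all add: rules) (simp_all add: rules defs)
    \<comment> \<open>The nonzero entry contracts the summand Y' common to \<open>B\<close> and
      \<open>P\<close>.\<close>
    show "HZero T B X \<in> Hom T (Dom T vt) (Dom T (i2 \<cdot> u))" "j2 \<cdot> m2 \<in> Hom T (Dom T wt) (Dom T vt)"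
      "HZero T (SigO T X) P \<in> Hom T (Cod T wt) (Dom T wt)"
      by (simp_all add: rules)
  qed (simp_all add: rules, simp_all add: rules defs)
  have S2: "is_sequence T (\<alpha>2, \<beta>2, w' \<cdot> q3)"
    by (simp add: is_sequence_iff rules)
  have e2: "(\<alpha>2, \<beta>2, w' \<cdot> q3) \<in> Exact T"
  proof (rule Exact_homotopy_retract[OF Exact2 S2])
    show "sequence_map T (u', v', w') (\<alpha>2, \<beta>2, w' \<cdot> q3) (Ide T X', n2, j3)"
      "sequence_map T (\<alpha>2, \<beta>2, w' \<cdot> q3) (u', v', w') (Ide T X', m2, q3)"
      unfolding sequence_map_iff[OF Exact_is_sequence[OF Exact2] S2]
        sequence_map_iff[OF S2 Exact_is_sequence[OF Exact2]]
      by (simp_all add: rules) (simp_all add: rules defs)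
    \<comment> \<open>The nonzero entry contracts the summand Z common to \<open>P\<close> and
      \<open>D\<close>.\<close>
    show "HZero T P X' \<in> Hom T (Dom T \<beta>2) (Dom T \<alpha>2)" "n1 \<cdot> p3 \<in> Hom T (Dom T (w' \<cdot> q3)) (Dom T \<beta>2)"
      "HZero T (SigO T X') D \<in> Hom T (Cod T (w' \<cdot> q3)) (Dom T (w' \<cdot> q3))"
      by (simp_all add: rules)
  qed (simp_all add: rules, simp_all add: rules defs)
  have "octahedron T (u, v, w) (i2, q2, HZero T Y' (SigO T Y)) (i2 \<cdot> u, vt, wt)
    (n1, m2, HZero T Y' (SigO T Z))"
    unfolding octahedron_def prod.case
    by (intro conjI Exact1 Exact_splittings c Exact_biproduct[OF b0]) (simp_all add: rules defs)
  moreover have "\<beta>2 \<cdot> vt = V"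
    by (rule biproduct_eqI'[OF biproduct2]; simp add: rules; simp add: rules defs)
  then have "octahedron T (i1, q1, HZero T X' (SigO T X)) (U, V, W) (i2 \<cdot> u, vt, wt)
    (\<alpha>2, \<beta>2, w' \<cdot> q3)"
    unfolding octahedron_def prod.case
    by (intro conjI Exact3 Exact_splittings c e2) (simp_all add: rules, simp_all add: rules defs)
  moreover have "i3 = \<beta>2 \<cdot> n1"
    by (simp add: rules defs)
  ultimately show ?thesis
    unfolding verdier_good_def prod.case using Exact_splittings c by blast
qed

text \<open>The composite u' q1 vanishes on the summand X, so its cone is \<Sigma>X \<oplus> Z'. One
  octahedron then contains the first triangle rotated twice plus the identity of Z', the other a
  split sequence.\<close>

lemma verdier_good_projection: "verdier_good T (U, V, W) (u', v', w') (q1, q2, q3)"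
proof -
  obtain P n1 n2 m1 m2 where b0: "is_biproduct T (SigO T X) Z' P n1 n2 m1 m2"
    using ex_biproduct[of "SigO T X" Z'] by auto
  note b = biproduct_simps(3-)[OF b0] biproduct_simps(4-)[OF Sigma_biproduct[OF b0]]
  define vt where "vt = n2 \<cdot> v'"
  define wt where "wt = (SigM T i1 \<cdot> m1) \<boxplus> (SigM T j1 \<cdot> (w' \<cdot> m2))"
  define \<alpha>1 where "\<alpha>1 = (n1 \<cdot> (w \<cdot> p3)) \<boxplus> (n2 \<cdot> q3)"
  \<comment> \<open>The sign is forced by the last octahedral equation, because the triangle on
    \<open>q2\<close> ends in -\<Sigma>i2.\<close>
  define \<beta>1 where "\<beta>1 = hneg T (SigM T u \<cdot> m1)"
  define \<gamma>1 where "\<gamma>1 = hneg T (SigM T i3 \<cdot> SigM T v)"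
  note defs = vt_def wt_def \<alpha>1_def \<beta>1_def \<gamma>1_def
  have ar: "vt \<in> Ar T" "Dom T vt = Y'" "Cod T vt = P" "wt \<in> Ar T" "Dom T wt = P"
    "Cod T wt = SigO T A" "\<alpha>1 \<in> Ar T" "Dom T \<alpha>1 = D" "Cod T \<alpha>1 = P"
    "\<beta>1 \<in> Ar T" "Dom T \<beta>1 = P" "Cod T \<beta>1 = SigO T Y"
    "\<gamma>1 \<in> Ar T" "Dom T \<gamma>1 = SigO T Y" "Cod T \<gamma>1 = SigO T D"
    by (simp_all add: defs b)
  note rules = b ar in_Hom_iff
  have S: "is_sequence T (u' \<cdot> q1, vt, wt)"
    by (simp add: is_sequence_iff rules)
  have c: "(u' \<cdot> q1, vt, wt) \<in> Exact T"
  proof (rule Exact_homotopy_retract[OF Exact2 S])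
    show "sequence_map T (u', v', w') (u' \<cdot> q1, vt, wt) (j1, Ide T Y', n2)"
      "sequence_map T (u' \<cdot> q1, vt, wt) (u', v', w') (q1, Ide T Y', m2)"
      unfolding sequence_map_iff[OF Exact_is_sequence[OF Exact2] S]
        sequence_map_iff[OF S Exact_is_sequence[OF Exact2]]
      by (simp_all add: rules) (simp_all add: rules defs)
    show "HZero T Y' A \<in> Hom T (Dom T vt) (Dom T (u' \<cdot> q1))" "HZero T P Y' \<in> Hom T (Dom T wt) (Dom T vt)"
      "n1 \<cdot> SigM T p1 \<in> Hom T (Cod T wt) (Dom T wt)"
      by (simp_all add: rules)
  qed (simp_all add: rules, simp_all add: rules defs)
  have S1: "is_sequence T (\<alpha>1, \<beta>1, \<gamma>1)"
    by (simp add: is_sequence_iff rules)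
  have E: "(w, hneg T (SigM T u), hneg T (SigM T v)) \<in> Exact T"
    by (intro Exact_rotate1 Exact1)
  have e1: "(\<alpha>1, \<beta>1, \<gamma>1) \<in> Exact T"
  proof (rule Exact_homotopy_retract[OF E S1])
    show "sequence_map T (w, hneg T (SigM T u), hneg T (SigM T v)) (\<alpha>1, \<beta>1, \<gamma>1)
        (i3, n1, Ide T (SigO T Y))"
      "sequence_map T (\<alpha>1, \<beta>1, \<gamma>1) (w, hneg T (SigM T u), hneg T (SigM T v))
        (p3, m1, Ide T (SigO T Y))"
      unfolding sequence_map_iff[OF Exact_is_sequence[OF E] S1]
        sequence_map_iff[OF S1 Exact_is_sequence[OF E]]
      by (simp_all add: rules) (simp_all add: rules defs)
    \<comment> \<open>The nonzero entry contracts the summand Z' common to \<open>D\<close> and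
      \<open>P\<close>.\<close>
    show "j3 \<cdot> m2 \<in> Hom T (Dom T \<beta>1) (Dom T \<alpha>1)"
      "HZero T (SigO T Y) P \<in> Hom T (Dom T \<gamma>1) (Dom T \<beta>1)"
      "HZero T (SigO T D) (SigO T Y) \<in> Hom T (Cod T \<gamma>1) (Dom T \<gamma>1)"
      by (simp_all add: rules)
  qed (simp_all add: rules, simp_all add: rules defs)
  \<comment> \<open>The composite of \<open>wt\<close> with the first map of the second octahedron
    has to be -\<Sigma>i1, the last arrow of the triangle on \<open>q1\<close>; this makes that map
    -n1. Changing the sign of \<open>n1\<close> and \<open>m1\<close> together keeps the biproduct,
    so the sequence is still split exact.\<close>
  have "is_biproduct T (SigO T X) Z' P (hneg T n1) n2 (hneg T m1) m2"
    by (simp add: is_biproduct_def rules)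
  from Exact_biproduct[OF this]
  have e2: "(hneg T n1, m2, HZero T Z' (SigO T (SigO T X))) \<in> Exact T" .
  have "wt \<cdot> \<alpha>1 = W"
    by (rule biproduct_eqI'[OF biproduct3]; simp add: rules; simp add: rules defs)
  then have "octahedron T (U, V, W) (q2, HZero T Y' (SigO T Y), hneg T (SigM T i2))
    (u' \<cdot> q1, vt, wt) (\<alpha>1, \<beta>1, \<gamma>1)"
    unfolding octahedron_def prod.case
    by (intro conjI Exact3 Exact_splittings c e1) (simp_all add: rules, simp_all add: rules defs)
  moreover have "octahedron T (q1, HZero T X' (SigO T X), hneg T (SigM T i1)) (u', v', w')
    (u' \<cdot> q1, vt, wt) (hneg T n1, m2, HZero T Z' (SigO T (SigO T X)))"
    unfolding octahedron_def prod.case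
    by (intro conjI Exact2 Exact_splittings c e2) (simp_all add: rules defs)
  moreover have "q3 = m2 \<cdot> \<alpha>1"
    by (simp add: rules defs)
  \<comment> \<open>The octahedra above are stated for u' q1, the definition of Verdier goodness for
    q2 U.\<close>
  moreover have "q2 \<cdot> U = u' \<cdot> q1"
    by simp
  ultimately show ?thesis
    unfolding verdier_good_def prod.case using Exact_splittings c by metis
qed

section \<open>Factorization through the direct sum\<close>

lemma factorization:
  assumes "sequence_map T (u, v, w) (u', v', w') (f, g, h)"
  shows "\<exists>s \<phi>1 \<phi>2. s \<in> Exact T \<and>
    triangle_map T (u, v, w) s \<phi>1 \<and> good T (u, v, w) s \<phi>1 \<and> verdier_good T (u, v, w) s \<phi>1 \<and>
    triangle_map T s (u', v', w') \<phi>2 \<and> good T s (u', v', w') \<phi>2 \<and>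
    verdier_good T s (u', v', w') \<phi>2 \<and> (f, g, h) = comp_map T \<phi>2 \<phi>1"
proof -
  \<comment> \<open>The first factor is the injection of the sheared decomposition, the second the
    projection of the original one, both on the same triangle. Their composite in degree one is q1
    (i1 + j1 f) = f, and likewise in the other degrees.\<close>
  define \<phi>1 where "\<phi>1 = (i1 \<boxplus> (j1 \<cdot> f), i2 \<boxplus> (j2 \<cdot> g), i3 \<boxplus> (j3 \<cdot> h))"
  note shear = shear[OF assms]
  have "(f, g, h) = comp_map T (q1, q2, q3) \<phi>1"
    using assms sequence_map_iff[OF Exact_is_sequence[OF Exact1] Exact_is_sequence[OF Exact2]]
    by (simp add: \<phi>1_def comp_map_def)
  moreover have "triangle_map T (u, v, w) (U, V, W) \<phi>1"
    "triangle_map T (U, V, W) (u', v', w') (q1, q2, q3)"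
    using triangle_biproduct.sequence_maps(1)[OF shear] sequence_maps(2) Exact1 Exact2 Exact3
    unfolding triangle_map_def \<phi>1_def by blast+
  moreover have "good T (u, v, w) (U, V, W) \<phi>1" "verdier_good T (u, v, w) (U, V, W) \<phi>1"
    unfolding \<phi>1_def
    by (rule triangle_biproduct.good_injection[OF shear]
        triangle_biproduct.verdier_good_injection[OF shear])+
  ultimately show ?thesis
    using Exact3 good_projection verdier_good_projection by blast
qed

end

theorem proposition5p5:
  fixes T :: "('o, 'm) tri_cat"
    and t t' \<phi> :: "'m \<times> 'm \<times> 'm"
  assumes "triangulated_category T"
    and "t \<in> Exact T"
    and "t' \<in> Exact T"
    and "triangle_map T t t' \<phi>"
  shows "\<exists>s \<phi>1 \<phi>2.
           s \<in> Exact T \<and>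
           triangle_map T t s \<phi>1 \<and> good T t s \<phi>1 \<and> verdier_good T t s \<phi>1 \<and>
           triangle_map T s t' \<phi>2 \<and> good T s t' \<phi>2 \<and> verdier_good T s t' \<phi>2 \<and>
           \<phi> = comp_map T \<phi>2 \<phi>1"
proof -
  interpret triangulated_category T by (rule assms(1))
  obtain u v w where t: "t = (u, v, w)" by (cases t)
  obtain u' v' w' where t': "t' = (u', v', w')" by (cases t')
  obtain f g h where \<phi>: "\<phi> = (f, g, h)" by (cases \<phi>)
  have E: "(u, v, w) \<in> Exact T" "(u', v', w') \<in> Exact T"
    and map: "sequence_map T (u, v, w) (u', v', w') (f, g, h)"
    using assms by (simp_all add: t t' \<phi> triangle_map_def)
  obtain A B D U V W i1 i2 i3 j1 j2 j3 p1 p2 p3 q1 q2 q3 where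
    "triangle_biproduct T (Dom T u) (Dom T v) (Dom T w) (Dom T u') (Dom T v') (Dom T w') A B D
      u v w u' v' w' U V W i1 i2 i3 j1 j2 j3 p1 p2 p3 q1 q2 q3"
    using Exact_direct_sum[OF E] by blast
  from triangle_biproduct.factorization[OF this map] show ?thesis
    unfolding t t' \<phi> by blast
qed

end
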